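(* Consider problem (P) under the standing assumptions of the context, and let $\{x^k\}$ be generated by the algorithm sESQM described in the context with $\mu_0>0$ and $\mu_k=\mu_0(1+k)^{-r}$ for all $k\in\mathbb{N}$, for some constant $r\in(0,1)$. Suppose that: (CQ) $0\notin \partial g(x)+\mathcal{N}_{\mathcal{C}}(x)$ for every $x\in\mathcal{C}$ with $g(x)\ge 0$; ($\widehat\gamma$) $\lim_{k\to\infty}\widehat\gamma_k=0$ and there is $M_{\widehat\gamma}>1$ with $0<\widehat\gamma_{k+1}<\widehat\gamma_k\le M_{\widehat\gamma}\widehat\gamma_{k+1}$ for all $k\in\mathbb{N}_0$. Let $M_1,\eta_\gamma,M_{\bar t},M_2,M_4$ be as defined in the context. Let $\epsilon_1\in(0,1)$, $\epsilon_2\in(0,1)$ and $K\in\mathbb{N}_0$ satisfy $$K\ge\max\left\{\left(\frac{\mu_0}{2^{2r+1}}\right)^{-\frac1{1-r}}\min\left\{\frac{\eta_\gamma^2\epsilon_1^2}{M_1^2M_2},\frac{\eta_\gamma^2c_2^2}{M_2}\right\}^{-\frac1{1-r}},\ 2M_{\bar t}+2M_4^{-\frac1r}\left(\frac{\epsilon_2}{\mu_0}\right)^{-\frac1r}\right\}.$$ Then there exists an integer $\hat k\in[\lceil K/2\rceil-M_{\bar t},K]$ such that $x^{\hat k+1}$ is an $(\epsilon_1,\epsilon_2)$-KKT point of (P). In other words, within $O(\max\{\epsilon_1^{-2/(1-r)},\epsilon_2^{-1/r}\})$ iterations, sESQM obtains an $(\epsilon_1,\epsilon_2)$-KKT point of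 (P). In particular, with $r=\frac13$, sESQM obtains an $(\epsilon_1,\epsilon_1)$-KKT point of (P) within $O(\epsilon_1^{-3})$ iterations.
   Context: **Notation.** $\mathbb{N}_0=\{0,1,2,\dots\}$; $[s]_+=\max\{s,0\}$; $\phi^+=\max\{\phi,0\}$; $\delta_{\mathcal{C}}$ is the indicator function (0 on $\mathcal{C}$, $+\infty$ off it); $\mathcal{N}_{\mathcal{C}}=\partial\delta_{\mathcal{C}}$ is the normal cone; $\partial_\epsilon\phi(x)=\{\xi:\phi(z)\ge\phi(x)+\langle\xi,z-x\rangle-\epsilon\ \forall z\}$ for convex $\phi$; $\partial$ is the limiting subdifferential (the usual one for convex functions); in the present setting $\partial g(x)=Dc(x)^*\partial h(c(x))$. "$L$-smooth on $\mathcal{C}$" means the derivative is $L$-Lipschitz on $\mathcal{C}$. $Dc(x)^*$ is the adjoint of the derivative. The constants hidden in $O(\cdot)$ do not depend on $\epsilon_1,\epsilon_2$. **Problem (P).** $\mathbb{X},\mathbb{Y}$ are finite-dimensional real Hilbert spaces: $$\min_{x\in\mathbb{X}}\ \psi(x):=f(x)+P_1(x)-P_2(x)+\delta_{\mathcal{C}}(x)\quad\text{s.t.}\quad g(x):=h(c(x))\le 0.$$ Standing assumptions: (i) $\mathcal{C}\subseteq\mathbb{X}$ is compact and convex and $\mathcal{F}:=\{x\in\mathcal{C}:g(x)\le0\}\ne\emptyset$; (ii) $f:\mathbb{X}\to\mathbb{R}$ and $c:\mathbb{X}\to\mathbb{Y}$ are continuously differentiable, $L_f$-smooth and $L_c$-smooth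 on $\mathcal{C}$ respectively ($L_f>0$, $L_c\ge0$), and $c$ is $M_c$-Lipschitz on $\mathcal{C}$ with $M_c>0$; (iii) $P_1,P_2:\mathbb{X}\to\mathbb{R}$ are convex; (iv) $h:\mathbb{Y}\to\mathbb{R}$ is convex and $M_h$-Lipschitz with $M_h>0$. **$(\epsilon_1,\epsilon_2)$-KKT point.** For $\epsilon_1,\epsilon_2\ge0$, $x\in\mathcal{C}$ is an $(\epsilon_1,\epsilon_2)$-KKT point of (P) if there exist $z\in\mathcal{C}$, $u\in\mathbb{Y}$ and $\lambda\ge0$ such that $\mathrm{dist}(0,\nabla f(x)+\partial P_1(x)-\partial P_2(z)+\lambda Dc(x)^*u+\mathcal{N}_{\mathcal{C}}(x))\le\epsilon_1$, $g(x)\le\epsilon_2$, $u\in\partial_{\epsilon_2}h(c(x))$, $|\lambda g(x)|\le\epsilon_2$ and $\|x-z\|\le\epsilon_1\epsilon_2$. **Smoothing.** A family of convex $C^1$ functions $\{\phi_\mu\}_{\mu>0}$ is a smoothing approximation (SA) of a convex $\phi:\mathbb{Y}\to\mathbb{R}$ with parameters $(\alpha_1^\phi,\alpha_2^\phi,\alpha_{3,1}^\phi,\alpha_{3,2}^\phi)$, where $\alpha_1^\phi\ge0$, $\alpha_2^\phi>0$, $\alpha_{3,1}^\phi,\alpha_{3,2}^\phi\in\mathbb{R}$ and $\alpha_3^\phi:=\alpha_{3,1}^\phi+\alpha_{3,2}^\phi>0$, if for all $\mu>0$: $\nabla\phi_\mu$ is $(\alpha_1^\phi+\alpha_2^\phi/\mu)$-Lipschitz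 and $\phi-\alpha_{3,1}^\phi\mu\le\phi_\mu\le\phi+\alpha_{3,2}^\phi\mu$ pointwise. Fixed throughout: an SA $\{h_\mu\}$ of $h$ with parameters $(\alpha_1^h,\alpha_2^h,\alpha_{3,1}^h,\alpha_{3,2}^h)$ and a constant $\alpha_4^h\ge0$ with $h_{\mu_1}(y)\le h_{\mu_0}(y)+\alpha_4^h(\mu_0-\mu_1)$ for all $\mu_0\ge\mu_1>0$, $y\in\mathbb{Y}$; and an SA $\{\varphi_\mu\}$ of $[\cdot]_+:\mathbb{R}\to\mathbb{R}$ with parameters $(\alpha_1^\varphi,\alpha_2^\varphi,\alpha_{3,1}^\varphi,\alpha_{3,2}^\varphi)$ and a constant $\alpha_4^\varphi\ge0$ with $\varphi_{\mu_1}(s)\le\varphi_{\mu_0}(s)+\alpha_4^\varphi(\mu_0-\mu_1)$ for all $\mu_0\ge\mu_1>0$, $s\in\mathbb{R}$. Set $H_\mu:=\varphi_\mu\circ h_\mu$, $g_\mu:=H_\mu\circ c$, $\alpha_1=\alpha_1^h+M_h^2\alpha_1^\varphi$, $\alpha_2=\alpha_2^h+M_h^2\alpha_2^\varphi$, $\alpha_{3,1}=[\alpha_{3,1}^h]_++\alpha_{3,1}^\varphi$, $\alpha_4=\alpha_4^h+\alpha_4^\varphi$, and $L_\mu:=M_hL_c+\alpha_1M_c^2+\alpha_2M_c^2/\mu$. **Algorithm sESQM.** Inputs: $x^0\in\mathcal{C}$, $\mu_0>0$, $\overline L\ge\underline L>0$, $c_1>0$, $c_2>0$, a strictly decreasing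 positive sequence $\{\widehat\gamma_k\}$, and the SAs above. Set $t_0=0$. For $k=0,1,2,\dots$: Step 1: take $\xi^k\in\partial P_2(x^k)$, $L_{k,0}\in[\underline L,\overline L]$; set $\gamma_k=\widehat\gamma_{t_k}$, $\widetilde L=L_{k,0}$. Step 2: compute $\widetilde x=\arg\min_{x\in\mathbb{X}}\{\gamma_k(\langle\nabla f(x^k)-\xi^k,x\rangle+P_1(x))+\ell_k(x)+\frac{\widetilde L}{2\mu_k}\|x-x^k\|^2+\delta_{\mathcal{C}}(x)\}$ with $\ell_k(x):=g_{\mu_k}(x^k)+\langle\nabla g_{\mu_k}(x^k),x-x^k\rangle$. Step 3: if $\gamma_k\psi(\widetilde x)+g_{\mu_k}(\widetilde x)\le\gamma_k\psi(x^k)+g_{\mu_k}(x^k)-\frac{c_1}{2\mu_k}\|\widetilde x-x^k\|^2$ go to Step 4; otherwise replace $\widetilde L$ by $2\widetilde L$ and go to Step 2. Step 4: set $x^{k+1}=\widetilde x$, $L_k=\widetilde L$. If $h_{\mu_k}(c(x^{k+1}))>2\alpha_3^\varphi\mu_k$ and $\|x^{k+1}-x^k\|\le c_2\mu_k\gamma_k$, set $t_{k+1}=t_k+1$; otherwise $t_{k+1}=t_k$. Step 5: choose $\mu_{k+1}\in(0,\mu_k]$ (here given by the explicit formula in the claim). **Constants.** $M_L:=\max\{\overline L,\ c_1+\gamma_0\mu_0L_f+\mu_0L_{\mu_0}\}$; $M_f:=\sup_{x\in\mathcal{C}}\|\nabla f(x)\|$; $M_{P_i}:=\sup\{\|\xi\|:\xi\in\partial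 P_i(x),x\in\mathcal{C}\}$, $i=1,2$; $M_1:=M_L+\mu_0\widehat\gamma_0L_f+\mu_0L_{\mu_0}$. $\eta_1>0$ is a constant (which exists under the standing assumptions and (CQ)) such that $\mathrm{dist}(0,Dc(x)^*u+\mathcal{N}_{\mathcal{C}}(x))\ge\eta_1$ for every $x\in\mathcal{C}$ with $g(x)\ge-\eta_1$ and every $u\in\partial_{\eta_1}h(c(x))$. With $k_0:=\min\{k\in\mathbb{N}_0:\mu_k\le\eta_1/\max\{\alpha_3^h,[\alpha_{3,2}^h]_+\}\}$, $$\eta_\gamma:=\min\left\{\frac{\eta_1}{2M_{\widehat\gamma}(M_f+M_{P_1}+M_{P_2}+c_2(M_L+\mu_0L_{\mu_0}))},\widehat\gamma_{k_0+1}\right\},\qquad M_{\bar t}:=\max\{t\in\mathbb{N}_0:\widehat\gamma_t\ge\eta_\gamma\}.$$ $M_2:=1+2(M_{\bar t}+1)(Q_0+[\alpha_{3,1}]_+\mu_0)/c_1$ with $Q_0:=\gamma_0(\psi(x^0)-\bar m)+g_{\mu_0}(x^0)+\alpha_4\mu_0$, $\bar m:=\inf_{x\in\mathbb{X}}\psi(x)$; $M_3:=(3\alpha_3^\varphi+[\alpha_{3,1}^h]_++[\alpha_{3,2}^h]_+)/\eta_\gamma$; $M_4:=\min\{1/\alpha_3^h,\ 1/M_3,\ M_1/\eta_\gamma,\ 1/(3\alpha_3^\varphi+[\alpha_{3,1}^h]_+)\}$. *)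

theory Defs
  imports "HOL-Analysis.Analysis"
begin

section \<open>Derivatives and smoothness\<close>

definition grad :: "('a::euclidean_space \<Rightarrow> real) \<Rightarrow> 'a \<Rightarrow> 'a" where
  "grad F x = (THE D. GDERIV F x :> D)"

text \<open>The derivative as a bounded linear operator, so that continuity and Lipschitz continuity
  of the derivative refer to the operator norm.  Only meaningful where \<open>F\<close> is differentiable.\<close>

definition deriv_op ::
  "('a::euclidean_space \<Rightarrow> 'b::euclidean_space) \<Rightarrow> 'a \<Rightarrow> 'a \<Rightarrow>\<^sub>L 'b" where
  "deriv_op F x = Blinfun (frechet_derivative F (at x))"

definition C1 :: "('a::euclidean_space \<Rightarrow> 'b::euclidean_space) \<Rightarrow> bool" where
  "C1 F \<longleftrightarrow> (\<forall>x. F differentiable (at x)) \<and> continuous_on UNIV (deriv_op F)"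

definition smooth_on ::
  "real \<Rightarrow> 'a::euclidean_space set \<Rightarrow> ('a \<Rightarrow> 'b::euclidean_space) \<Rightarrow> bool" where
  "smooth_on L S F \<longleftrightarrow> L-lipschitz_on S (deriv_op F)"

definition pos_part :: "real \<Rightarrow> real" where
  "pos_part s = max s 0"


section \<open>Subdifferentials and normal cones\<close>

definition eps_subdiff :: "real \<Rightarrow> ('a::euclidean_space \<Rightarrow> real) \<Rightarrow> 'a \<Rightarrow> 'a set" where
  "eps_subdiff \<epsilon> \<phi> x = {\<xi>. \<forall>z. \<phi> z \<ge> \<phi> x + \<xi> \<bullet> (z - x) - \<epsilon>}"

definition subdiff :: "('a::euclidean_space \<Rightarrow> real) \<Rightarrow> 'a \<Rightarrow> 'a set" where
  "subdiff \<phi> x = {\<xi>. \<forall>z. \<phi> z \<ge> \<phi> x + \<xi> \<bullet> (z - x)}"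

definition frechet_subdiff :: "('a::euclidean_space \<Rightarrow> real) \<Rightarrow> 'a \<Rightarrow> 'a set" where
  "frechet_subdiff \<phi> x =
     {\<xi>. \<forall>e>0. \<forall>\<^sub>F y in at x. \<phi> y \<ge> \<phi> x + \<xi> \<bullet> (y - x) - e * norm (y - x)}"

definition limiting_subdiff :: "('a::euclidean_space \<Rightarrow> real) \<Rightarrow> 'a \<Rightarrow> 'a set" where
  "limiting_subdiff \<phi> x =
     {\<xi>. \<exists>X \<Xi>. X \<longlonglongrightarrow> x \<and> (\<lambda>n. \<phi> (X n)) \<longlonglongrightarrow> \<phi> x \<and>
            (\<forall>n. \<Xi> n \<in> frechet_subdiff \<phi> (X n)) \<and> \<Xi> \<longlonglongrightarrow> \<xi>}"

definition indicator_fn :: "'a set \<Rightarrow> 'a \<Rightarrow> ereal" where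
  "indicator_fn C x = (if x \<in> C then 0 else \<infinity>)"

text \<open>The convex subdifferential of \<^term>\<open>indicator_fn C\<close>, written out.\<close>

definition normal_cone :: "'a::euclidean_space set \<Rightarrow> 'a \<Rightarrow> 'a set" where
  "normal_cone C x = (if x \<in> C then {v. \<forall>z\<in>C. v \<bullet> (z - x) \<le> 0} else {})"


section \<open>Objective, approximate KKT points, constraint qualification\<close>

definition \<psi>_fn ::
  "('a \<Rightarrow> real) \<Rightarrow> ('a \<Rightarrow> real) \<Rightarrow> ('a \<Rightarrow> real) \<Rightarrow> 'a set \<Rightarrow> 'a \<Rightarrow> ereal" where
  "\<psi>_fn f P1 P2 C x = ereal (f x + P1 x - P2 x) + indicator_fn C x"

definition kkt_residuals where
  "kkt_residuals f P1 P2 C c x z l (u::'b::euclidean_space) =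
     {grad f x + p - q + l *\<^sub>R adjoint (frechet_derivative c (at x)) u + v | p q v.
        p \<in> subdiff P1 x \<and> q \<in> subdiff P2 z \<and> v \<in> normal_cone C (x::'a::euclidean_space)}"

text \<open>Nonemptiness is required explicitly, because \<^term>\<open>infdist 0 {}\<close> is \<open>0\<close>
  whereas the distance to the empty set should be infinite.\<close>

definition kkt_point ::
  "('a::euclidean_space \<Rightarrow> real) \<Rightarrow> ('a \<Rightarrow> real) \<Rightarrow> ('a \<Rightarrow> real) \<Rightarrow> 'a set \<Rightarrow>
   ('b::euclidean_space \<Rightarrow> real) \<Rightarrow> ('a \<Rightarrow> 'b) \<Rightarrow> real \<Rightarrow> real \<Rightarrow> 'a \<Rightarrow> bool" where
  "kkt_point f P1 P2 C h c \<epsilon>1 \<epsilon>2 x \<longleftrightarrow>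
     x \<in> C \<and>
     (\<exists>z u l. z \<in> C \<and> l \<ge> 0 \<and>
        kkt_residuals f P1 P2 C c x z l u \<noteq> {} \<and>
        infdist 0 (kkt_residuals f P1 P2 C c x z l u) \<le> \<epsilon>1 \<and>
        h (c x) \<le> \<epsilon>2 \<and>
        u \<in> eps_subdiff \<epsilon>2 h (c x) \<and>
        \<bar>l * h (c x)\<bar> \<le> \<epsilon>2 \<and>
        norm (x - z) \<le> \<epsilon>1 * \<epsilon>2)"

definition CQ ::
  "'a::euclidean_space set \<Rightarrow> ('b::euclidean_space \<Rightarrow> real) \<Rightarrow> ('a \<Rightarrow> 'b) \<Rightarrow> bool" where
  "CQ C h c \<longleftrightarrow>
     (\<forall>x\<in>C. h (c x) \<ge> 0 \<longrightarrow>
        0 \<notin> {a + v | a v. a \<in> limiting_subdiff (\<lambda>y. h (c y)) x \<and> v \<in> normal_cone C x})"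

text \<open>The set in \<open>infdist\<close> is nonempty for \<open>x \<in> C\<close>, as \<open>0\<close> is a normal vector.\<close>

definition cq_constant ::
  "'a::euclidean_space set \<Rightarrow> ('b::euclidean_space \<Rightarrow> real) \<Rightarrow> ('a \<Rightarrow> 'b) \<Rightarrow> real \<Rightarrow> bool" where
  "cq_constant C h c \<eta> \<longleftrightarrow>
     \<eta> > 0 \<and>
     (\<forall>x\<in>C. h (c x) \<ge> - \<eta> \<longrightarrow>
        (\<forall>u \<in> eps_subdiff \<eta> h (c x).
           infdist 0 {adjoint (frechet_derivative c (at x)) u + v | v. v \<in> normal_cone C x} \<ge> \<eta>))"


section \<open>Smoothing approximations\<close>

definition smoothing_approx ::
  "('a::euclidean_space \<Rightarrow> real) \<Rightarrow> (real \<Rightarrow> 'a \<Rightarrow> real) \<Rightarrow> real \<Rightarrow> real \<Rightarrow> real \<Rightarrow> real \<Rightarrow> bool" where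
  "smoothing_approx \<phi> \<Phi> a1 a2 a31 a32 \<longleftrightarrow>
     convex_on UNIV \<phi> \<and> a1 \<ge> 0 \<and> a2 > 0 \<and> a31 + a32 > 0 \<and>
     (\<forall>\<mu>>0. convex_on UNIV (\<Phi> \<mu>) \<and> C1 (\<Phi> \<mu>) \<and>
        (a1 + a2 / \<mu>)-lipschitz_on UNIV (grad (\<Phi> \<mu>)) \<and>
        (\<forall>y. \<phi> y - a31 * \<mu> \<le> \<Phi> \<mu> y \<and> \<Phi> \<mu> y \<le> \<phi> y + a32 * \<mu>))"

definition smoothing_mono :: "(real \<Rightarrow> 'a \<Rightarrow> real) \<Rightarrow> real \<Rightarrow> bool" where
  "smoothing_mono \<Phi> a4 \<longleftrightarrow>
     a4 \<ge> 0 \<and>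
     (\<forall>\<mu>0 \<mu>1 y. 0 < \<mu>1 \<and> \<mu>1 \<le> \<mu>0 \<longrightarrow> \<Phi> \<mu>1 y \<le> \<Phi> \<mu>0 y + a4 * (\<mu>0 - \<mu>1))"

definition g_smooth ::
  "(real \<Rightarrow> 'b \<Rightarrow> real) \<Rightarrow> (real \<Rightarrow> real \<Rightarrow> real) \<Rightarrow> ('a \<Rightarrow> 'b) \<Rightarrow> real \<Rightarrow> 'a \<Rightarrow> real" where
  "g_smooth hs \<phi>s c \<mu> x = \<phi>s \<mu> (hs \<mu> (c x))"


section \<open>The algorithm\<close>

text \<open>Objective of the subproblem at the iterate \<open>xk\<close>; \<open>G\<close> is the smoothed constraint function
  for the current smoothing parameter.\<close>

definition sub_objective ::
  "('a::euclidean_space \<Rightarrow> real) \<Rightarrow> ('a \<Rightarrow> real) \<Rightarrow> 'a set \<Rightarrow> ('a \<Rightarrow> real) \<Rightarrow>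
   real \<Rightarrow> real \<Rightarrow> 'a \<Rightarrow> 'a \<Rightarrow> real \<Rightarrow> 'a \<Rightarrow> ereal" where
  "sub_objective f P1 C G \<gamma> \<mu> xk \<xi> L x =
     ereal (\<gamma> * ((grad f xk - \<xi>) \<bullet> x + P1 x)
            + (G xk + grad G xk \<bullet> (x - xk))
            + L / (2 * \<mu>) * (norm (x - xk))\<^sup>2)
     + indicator_fn C x"

definition sub_solution ::
  "('a::euclidean_space \<Rightarrow> real) \<Rightarrow> ('a \<Rightarrow> real) \<Rightarrow> 'a set \<Rightarrow> ('a \<Rightarrow> real) \<Rightarrow>
   real \<Rightarrow> real \<Rightarrow> 'a \<Rightarrow> 'a \<Rightarrow> real \<Rightarrow> 'a \<Rightarrow> bool" where
  "sub_solution f P1 C G \<gamma> \<mu> xk \<xi> L x \<longleftrightarrow>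
     is_arg_min (sub_objective f P1 C G \<gamma> \<mu> xk \<xi> L) (\<lambda>_. True) x"

definition decrease_test ::
  "('a::euclidean_space \<Rightarrow> ereal) \<Rightarrow> ('a \<Rightarrow> real) \<Rightarrow> real \<Rightarrow> real \<Rightarrow> real \<Rightarrow> 'a \<Rightarrow> 'a \<Rightarrow> bool" where
  "decrease_test \<psi> G c1 \<gamma> \<mu> xk x \<longleftrightarrow>
     ereal \<gamma> * \<psi> x + ereal (G x)
       \<le> ereal \<gamma> * \<psi> xk + ereal (G xk) - ereal (c1 / (2 * \<mu>) * (norm (x - xk))\<^sup>2)"

text \<open>One pass through the line search and the update of the penalty index.  The accepted
  constant is \<open>2 ^ i * L0\<close>, where all trial constants with fewer doublings were rejected.\<close>

definition sesqm_step ::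
  "('a::euclidean_space \<Rightarrow> real) \<Rightarrow> ('a \<Rightarrow> real) \<Rightarrow> ('a \<Rightarrow> real) \<Rightarrow> 'a set \<Rightarrow> ('a \<Rightarrow> 'b) \<Rightarrow>
   (real \<Rightarrow> 'b \<Rightarrow> real) \<Rightarrow> (real \<Rightarrow> real \<Rightarrow> real) \<Rightarrow> real \<Rightarrow> real \<Rightarrow> real \<Rightarrow>
   real \<Rightarrow> real \<Rightarrow> 'a \<Rightarrow> 'a \<Rightarrow> real \<Rightarrow> real \<Rightarrow> 'a \<Rightarrow> nat \<Rightarrow> nat \<Rightarrow> bool" where
  "sesqm_step f P1 P2 C c hs \<phi>s \<alpha>3\<phi> c1 c2 \<gamma> \<mu> xk \<xi> L0 L xk' tk tk' \<longleftrightarrow>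
     (let G = g_smooth hs \<phi>s c \<mu>; \<psi> = \<psi>_fn f P1 P2 C in
      (\<exists>i::nat.
         L = 2 ^ i * L0 \<and>
         sub_solution f P1 C G \<gamma> \<mu> xk \<xi> L xk' \<and>
         decrease_test \<psi> G c1 \<gamma> \<mu> xk xk' \<and>
         (\<forall>j<i. \<forall>y. sub_solution f P1 C G \<gamma> \<mu> xk \<xi> (2 ^ j * L0) y
                      \<longrightarrow> \<not> decrease_test \<psi> G c1 \<gamma> \<mu> xk y)) \<and>
      tk' = (if hs \<mu> (c xk') > 2 * \<alpha>3\<phi> * \<mu> \<and> norm (xk' - xk) \<le> c2 * \<mu> * \<gamma>
             then tk + 1 else tk))"

definition sesqm_run ::
  "('a::euclidean_space \<Rightarrow> real) \<Rightarrow> ('a \<Rightarrow> real) \<Rightarrow> ('a \<Rightarrow> real) \<Rightarrow> 'a set \<Rightarrow> ('a \<Rightarrow> 'b) \<Rightarrow>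
   (real \<Rightarrow> 'b \<Rightarrow> real) \<Rightarrow> (real \<Rightarrow> real \<Rightarrow> real) \<Rightarrow> real \<Rightarrow> real \<Rightarrow> real \<Rightarrow> real \<Rightarrow> real \<Rightarrow>
   (nat \<Rightarrow> real) \<Rightarrow> (nat \<Rightarrow> real) \<Rightarrow>
   (nat \<Rightarrow> 'a) \<Rightarrow> (nat \<Rightarrow> 'a) \<Rightarrow> (nat \<Rightarrow> real) \<Rightarrow> (nat \<Rightarrow> real) \<Rightarrow> (nat \<Rightarrow> nat) \<Rightarrow> bool" where
  "sesqm_run f P1 P2 C c hs \<phi>s \<alpha>3\<phi> c1 c2 Llow Lup \<gamma>hat \<mu> x \<xi> L0 L t \<longleftrightarrow>
     x 0 \<in> C \<and> \<mu> 0 > 0 \<and> t 0 = 0 \<and>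
     (\<forall>k. \<xi> k \<in> subdiff P2 (x k) \<and> Llow \<le> L0 k \<and> L0 k \<le> Lup \<and>
          sesqm_step f P1 P2 C c hs \<phi>s \<alpha>3\<phi> c1 c2 (\<gamma>hat (t k)) (\<mu> k)
            (x k) (\<xi> k) (L0 k) (L k) (x (Suc k)) (t k) (t (Suc k)) \<and>
          0 < \<mu> (Suc k) \<and> \<mu> (Suc k) \<le> \<mu> k)"


section \<open>Bounds on gradients and subgradients\<close>

definition grad_bound :: "('a::euclidean_space \<Rightarrow> real) \<Rightarrow> 'a set \<Rightarrow> real" where
  "grad_bound f C = (SUP x\<in>C. norm (grad f x))"

definition subgrad_bound :: "('a::euclidean_space \<Rightarrow> real) \<Rightarrow> 'a set \<Rightarrow> real" where
  "subgrad_bound P C = Sup {norm \<xi> | \<xi> x. x \<in> C \<and> \<xi> \<in> subdiff P x}"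

end

theory Submission
  imports Defs
begin

text \<open>
  Up to first order, one step from \<open>x k\<close> with parameters \<open>\<gamma> k\<close> and \<open>\<mu> k\<close> makes \<open>x (k + 1)\<close>
  stationary with an error proportional to \<open>norm (x (k + 1) - x k) / (\<gamma> k * \<mu> k)\<close>.  The multiplier is
  \<open>\<phi>s' (h\<mu> (c x)) / \<gamma> k\<close>, and the gradient of the smoothed \<open>h\<close> is an approximate subgradient of \<open>h\<close>
  with an error of order \<open>\<mu> k\<close>.  Feasibility and complementarity also hold up to order
  \<open>\<mu> k\<close> once the smoothed constraint value is at most \<open>2 * \<alpha>3\<phi> * \<mu> k\<close>
  (\<open>kkt_point_if_small_step\<close>).  So three things are needed: a penalty weight \<open>\<gamma> k\<close> bounded below,
  a step that is short relative to \<open>\<mu> k\<close>, and an index at which the penalty is not updated.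

  The weight stays bounded below because of the constraint qualification.  At an update the
  derivative of \<open>\<phi>s\<close> is at least \<open>1 / 2\<close>, so dividing the optimality condition of the subproblem by
  it exhibits an element of \<open>Dc(x)\<^sup>* u + N(x)\<close> of norm \<open>O(\<gamma> k)\<close>; this norm is at least \<open>\<eta>\<close> by the
  qualification (\<open>\<gamma>_ge_at_update\<close>).  Hence updates stop once \<open>\<gamma> k\<close> is small, and at
  most \<open>Mt\<close> of them occur (\<open>\<gamma>_ge\<close>, \<open>t_eq_card_updates\<close>).

  Short steps exist because the penalised objective, with the drift of the smoothing compensated, is a
  potential that decreases by a multiple of \<open>norm (x (k + 1) - x k)^2 / \<mu> k\<close> at each step and is bounded
  below, so that these quantities have a bounded sum (\<open>sum_squared_steps_le\<close>).  A window
  containing \<open>Mt\<close> more than half of the first \<open>K\<close> indices contains at least \<open>K / 2\<close> indices without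
  an update.  As \<open>\<mu>\<close> sums to order \<open>K powr (1 - r)\<close> over these, one of them has
  \<open>(norm (x (k + 1) - x k) / \<mu> k)^2\<close> of order \<open>1 / K powr (1 - r)\<close> (\<open>small_step_exists\<close>), and at that index
  \<open>\<mu> k\<close> is still of order \<open>K powr (- r)\<close>.  Balancing the two orders gives the bound on \<open>K\<close>.

  One point is delicate.  The map \<open>c\<close> is only Lipschitz on \<open>C\<close>, which may have empty interior, so
  its derivative is controlled only along the directions spanned by \<open>C\<close>.  All estimates
  of gradients of the smoothed constraint are therefore made against such directions; the uncontrolled
  orthogonal component is a normal vector in both signs and disappears into the normal cone
  (\<open>normal_cone_absorbs\<close>).
\<close>

section \<open>Gradients and the descent inequality\<close>

lemma has_derivative_grad:
  fixes F :: "'a::euclidean_space \<Rightarrow> real"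
  assumes "F differentiable (at x)"
  shows "(F has_derivative (\<lambda>d. grad F x \<bullet> d)) (at x)"
proof -
  obtain A where A: "(F has_derivative A) (at x)"
    using assms by (auto simp: differentiable_def)
  then have "A = (\<lambda>d. d \<bullet> adjoint A 1)"
    using adjoint_works[of A _ 1] has_derivative_linear[OF A] by auto
  with A have *: "GDERIV F x :> adjoint A 1"
    by (simp add: gderiv_def)
  have "D = adjoint A 1" if "GDERIV F x :> D" for D
    using has_derivative_unique[OF that[unfolded gderiv_def] *[unfolded gderiv_def]]
    by (simp add: fun_eq_iff vector_eq_ldot)
  then have "GDERIV F x :> grad F x"
    unfolding grad_def by (metis (mono_tags, lifting) * the_equality)
  then show ?thesis
    by (simp add: gderiv_def inner_commute)
qed

lemma grad_eqI:
  assumes "(F has_derivative (\<lambda>d. D \<bullet> d)) (at x)"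
  shows "grad F x = D"
proof -
  have "F differentiable (at x)"
    using assms by (auto simp: differentiable_def)
  from has_derivative_unique[OF has_derivative_grad[OF this] assms]
  have "\<forall>d. grad F x \<bullet> d = D \<bullet> d" by (simp add: fun_eq_iff)
  then show ?thesis by (simp add: vector_eq_rdot)
qed

lemma deriv_op_apply:
  fixes F :: "'a::euclidean_space \<Rightarrow> 'b::euclidean_space"
  assumes "F differentiable (at x)"
  shows "blinfun_apply (deriv_op F x) = frechet_derivative F (at x)"
  unfolding deriv_op_def
  by (intro bounded_linear_Blinfun_apply has_derivative_bounded_linear[of F])
     (use assms frechet_derivative_works in blast)

lemma norm_le_of_inner_le:
  fixes w :: "'a::real_inner"
  assumes "w \<bullet> w \<le> B * norm w" "0 \<le> B"
  shows "norm w \<le> B"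
proof (cases "w = 0")
  case False
  then show ?thesis using assms
    by (simp add: power2_norm_eq_inner[symmetric] power2_eq_square)
qed (use assms in simp)

lemma norm_grad_diff_le:
  assumes "F differentiable (at x)" "F differentiable (at y)"
  shows "norm (grad F x - grad F y) \<le> norm (deriv_op F x - deriv_op F y)"
proof -
  let ?w = "grad F x - grad F y"
  have "frechet_derivative F (at z) d = grad F z \<bullet> d" if "F differentiable (at z)" for z d
    using frechet_derivative_at[OF has_derivative_grad[OF that]] by metis
  then have "?w \<bullet> ?w = blinfun_apply (deriv_op F x - deriv_op F y) ?w"
    using assms by (simp add: minus_blinfun.rep_eq deriv_op_apply inner_diff_left)
  also have "\<dots> \<le> norm (deriv_op F x - deriv_op F y) * norm ?w"
    using norm_blinfun[of "deriv_op F x - deriv_op F y" ?w] by (simp only: real_norm_def abs_le_iff)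
  finally show ?thesis
    by (rule norm_le_of_inner_le) simp
qed

lemma C1_differentiable: "C1 F \<Longrightarrow> F differentiable (at x)"
  by (simp add: C1_def)

lemma continuous_on_frechet_derivative_apply:
  assumes "C1 F"
  shows "continuous_on S (\<lambda>x. frechet_derivative F (at x) d)"
proof -
  have "continuous_on UNIV (\<lambda>x. blinfun_apply (deriv_op F x) d)"
    using assms by (intro continuous_intros) (auto simp: C1_def)
  then show ?thesis
    using assms by (auto simp: deriv_op_apply C1_differentiable intro: continuous_on_subset)
qed

lemma C1_continuous_on: "C1 F \<Longrightarrow> continuous_on S F"
  using C1_differentiable[of F]
  by (intro continuous_at_imp_continuous_on ballI) (rule differentiable_imp_continuous_within)

lemma norm_grad_le_norm_deriv_op:
  assumes "F differentiable (at x)"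
  shows "norm (grad F x) \<le> norm (deriv_op F x)"
proof -
  have "frechet_derivative F (at x) (grad F x) = grad F x \<bullet> grad F x"
    using frechet_derivative_at[OF has_derivative_grad[OF assms]] by metis
  then have "grad F x \<bullet> grad F x = blinfun_apply (deriv_op F x) (grad F x)"
    by (simp only: deriv_op_apply[OF assms])
  also have "\<dots> \<le> norm (deriv_op F x) * norm (grad F x)"
    using norm_blinfun[of "deriv_op F x" "grad F x"] by (simp only: real_norm_def abs_le_iff)
  finally show ?thesis
    by (rule norm_le_of_inner_le) simp
qed

text \<open>The Lipschitz hypothesis is directional so that it applies to gradients that are controlled only along
  directions of \<open>C\<close>, such as those of the smoothed constraint.\<close>

lemma descent_inequality:
  fixes F :: "'a::euclidean_space \<Rightarrow> real"
  assumes diff: "\<And>z. F differentiable (at z)"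
    and C: "convex C" "x \<in> C" "y \<in> C"
    and lip: "\<And>z. z \<in> C \<Longrightarrow> (grad F z - grad F x) \<bullet> (y - x) \<le> B * norm (z - x) * norm (y - x)"
  shows "F y \<le> F x + grad F x \<bullet> (y - x) + B / 2 * (norm (y - x))\<^sup>2"
proof -
  define d where "d = y - x"
  define q where "q s = F (x + s *\<^sub>R d) - s * (grad F x \<bullet> d) - B / 2 * s\<^sup>2 * (norm d)\<^sup>2" for s
  have deriv: "(q has_real_derivative
      (grad F (x + s *\<^sub>R d) - grad F x) \<bullet> d - B * s * (norm d)\<^sup>2) (at s)" for s
  proof -
    have "((\<lambda>s. F (x + s *\<^sub>R d)) has_derivative (\<lambda>u. grad F (x + s *\<^sub>R d) \<bullet> (u *\<^sub>R d))) (at s)"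
      by (rule has_derivative_compose[where f = "\<lambda>s. x + s *\<^sub>R d" and g = F])
         (auto intro!: derivative_eq_intros has_derivative_grad[OF diff])
    then have "((\<lambda>s. F (x + s *\<^sub>R d)) has_real_derivative grad F (x + s *\<^sub>R d) \<bullet> d) (at s)"
      by (simp add: has_field_derivative_def mult.commute[of _ "_ \<bullet> _"])
    then show ?thesis
      unfolding q_def by (auto intro!: derivative_eq_intros simp: inner_diff_left)
  qed
  have "q 1 \<le> q 0"
  proof (rule DERIV_nonpos_imp_nonincreasing[of 0 1 q])
    fix s :: real assume s: "0 \<le> s" "s \<le> 1"
    have "x + s *\<^sub>R d = (1 - s) *\<^sub>R x + s *\<^sub>R y"
      by (simp add: d_def algebra_simps)
    then have "x + s *\<^sub>R d \<in> C"
      using convexD_alt[OF C s] by simp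
    from lip[OF this] have "(grad F (x + s *\<^sub>R d) - grad F x) \<bullet> d \<le> B * s * (norm d)\<^sup>2"
      using s by (simp add: d_def[symmetric] power2_eq_square algebra_simps)
    then show "\<exists>y. (q has_real_derivative y) (at s) \<and> y \<le> 0"
      using deriv[of s] by force
  qed simp
  then show ?thesis by (simp add: q_def d_def)
qed

section \<open>Approximate subgradients\<close>

text \<open>Moving far along \<open>\<xi>\<close> makes the fixed error \<open>e\<close> negligible against the linear growth, so even an
  approximate subgradient cannot exceed the global Lipschitz constant.  Applied to the gradients of a
  smoothing approximation, this bounds them by the constant of the unsmoothed function.\<close>

lemma norm_eps_subdiff_le:
  assumes lip: "M-lipschitz_on UNIV \<phi>" and xi: "\<xi> \<in> eps_subdiff e \<phi> x"
  shows "norm \<xi> \<le> M"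
proof (rule field_le_epsilon)
  have M: "0 \<le> M" using lip by (rule lipschitz_on_nonneg)
  fix d :: real assume d: "0 < d"
  show "norm \<xi> \<le> M + d"
  proof (cases "\<xi> = 0")
    case False
    define n where "n = norm \<xi>"
    have n: "n > 0" using False by (simp add: n_def)
    \<comment> \<open>chosen such that a slack of \<open>d\<close> in the slope outweighs the error \<open>e\<close>\<close>
    define s where "s = (\<bar>e\<bar> + 1) / (d * n)"
    have s: "s > 0" using d n by (simp add: s_def)
    have "\<phi> (x + s *\<^sub>R \<xi>) \<ge> \<phi> x + \<xi> \<bullet> (s *\<^sub>R \<xi>) - e"
      using xi by (auto simp: eps_subdiff_def dest: spec[of _ "x + s *\<^sub>R \<xi>"])
    moreover have "\<phi> (x + s *\<^sub>R \<xi>) - \<phi> x \<le> M * (s * n)"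
      using lipschitz_onD[OF lip, of "x + s *\<^sub>R \<xi>" x] s by (simp add: dist_norm n_def abs_le_iff)
    moreover have "\<xi> \<bullet> (s *\<^sub>R \<xi>) = s * n * n"
      by (simp add: n_def power2_norm_eq_inner[symmetric] power2_eq_square)
    ultimately have "s * n * n \<le> M * (s * n) + e" by linarith
    moreover have "s * n * d = \<bar>e\<bar> + 1" using d n by (simp add: s_def)
    ultimately have "s * n * n \<le> s * n * (M + d)" by (simp add: algebra_simps)
    then show ?thesis using s n by (simp add: n_def)
  qed (use M d in simp)
qed

text \<open>The bounds come from the slopes of the positive part at the two infinities, where the error \<open>e\<close>
  does not count.\<close>

lemma eps_subdiff_pos_part:
  assumes "a \<in> eps_subdiff e pos_part s"
  shows "0 \<le> a" "a \<le> 1"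
proof -
  have *: "pos_part z \<ge> pos_part s + a * (z - s) - e" for z
    using assms by (simp add: eps_subdiff_def)
  show "0 \<le> a"
  proof (rule ccontr)
    assume a: "\<not> 0 \<le> a"
    define z where "z = min 0 (s + (\<bar>e\<bar> + 1) / a)"
    have "z \<le> s + (\<bar>e\<bar> + 1) / a" by (simp add: z_def)
    then have "a * (z - s) \<ge> \<bar>e\<bar> + 1" using a by (simp add: field_simps)
    moreover have "pos_part z = 0" by (simp add: z_def pos_part_def)
    moreover have "pos_part s \<ge> 0" by (simp add: pos_part_def)
    ultimately show False using *[of z] by linarith
  qed
  show "a \<le> 1"
  proof (rule ccontr)
    assume a: "\<not> a \<le> 1"
    define z where "z = max (max 0 s) (s + (\<bar>e\<bar> + 1) / (a - 1))"
    have "z \<ge> s + (\<bar>e\<bar> + 1) / (a - 1)" by (simp add: z_def)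
    then have "(a - 1) * (z - s) \<ge> \<bar>e\<bar> + 1" using a by (simp add: field_simps)
    moreover have "pos_part z = z" by (simp add: z_def pos_part_def)
    moreover have "pos_part s \<ge> s" by (simp add: pos_part_def)
    ultimately show False using *[of z] by (simp add: algebra_simps)
  qed
qed

lemma grad_convex_in_subdiff:
  fixes F :: "'a::euclidean_space \<Rightarrow> real"
  assumes conv: "convex_on UNIV F" and diff: "F differentiable (at x)"
  shows "grad F x \<in> subdiff F x"
  unfolding subdiff_def
proof (intro CollectI allI)
  fix z
  define q where "q s = F (x + s *\<^sub>R (z - x))" for s :: real
  have "convex_on UNIV q"
  proof (rule convex_onI)
    fix s u v :: real assume s: "0 < s" "s < 1"
    have "x + ((1 - s) *\<^sub>R u + s *\<^sub>R v) *\<^sub>R (z - x)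
        = (1 - s) *\<^sub>R (x + u *\<^sub>R (z - x)) + s *\<^sub>R (x + v *\<^sub>R (z - x))"
      by (simp add: algebra_simps)
    then show "q ((1 - s) *\<^sub>R u + s *\<^sub>R v) \<le> (1 - s) * q u + s * q v"
      using convex_onD[OF conv, of s "x + u *\<^sub>R (z - x)" "x + v *\<^sub>R (z - x)"] s
      by (simp add: q_def)
  qed simp
  moreover have "(q has_real_derivative grad F x \<bullet> (z - x)) (at 0)"
  proof -
    have "(q has_derivative (\<lambda>u. grad F x \<bullet> (u *\<^sub>R (z - x)))) (at 0)"
      unfolding q_def
      by (rule has_derivative_compose[where f = "\<lambda>s. x + s *\<^sub>R (z - x)" and g = F])
         (auto intro!: derivative_eq_intros has_derivative_grad[OF diff])
    then show ?thesis
      by (simp add: has_field_derivative_def mult.commute[of _ "_ \<bullet> _"])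
  qed
  ultimately have "q 1 - q 0 \<ge> grad F x \<bullet> (z - x) * (1 - 0)"
    by (intro convex_on_imp_above_tangent[of UNIV]) auto
  then show "F x + grad F x \<bullet> (z - x) \<le> F z"
    by (simp add: q_def)
qed

lemma grad_smoothing_in_eps_subdiff:
  assumes sa: "smoothing_approx \<phi> \<Phi> a1 a2 a31 a32" and mu: "\<mu> > 0"
  shows "grad (\<Phi> \<mu>) y \<in> eps_subdiff ((a31 + a32) * \<mu>) \<phi> y"
  unfolding eps_subdiff_def
proof (intro CollectI allI)
  fix z
  have "convex_on UNIV (\<Phi> \<mu>)" "C1 (\<Phi> \<mu>)"
    and *: "\<And>y. \<phi> y - a31 * \<mu> \<le> \<Phi> \<mu> y \<and> \<Phi> \<mu> y \<le> \<phi> y + a32 * \<mu>"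
    using sa mu by (auto simp: smoothing_approx_def)
  then have "grad (\<Phi> \<mu>) y \<in> subdiff (\<Phi> \<mu>) y"
    by (intro grad_convex_in_subdiff C1_differentiable)
  then have "\<Phi> \<mu> z \<ge> \<Phi> \<mu> y + grad (\<Phi> \<mu>) y \<bullet> (z - y)"
    by (simp add: subdiff_def)
  then show "\<phi> z \<ge> \<phi> y + grad (\<Phi> \<mu>) y \<bullet> (z - y) - (a31 + a32) * \<mu>"
    using *[of z] *[of y] by (simp add: distrib_right)
qed

lemma convex_on_imp_continuous_on: "convex_on UNIV (P :: 'a::euclidean_space \<Rightarrow> real) \<Longrightarrow> continuous_on S P"
  using convex_on_continuous[OF open_UNIV] continuous_on_subset by blast

text \<open>A unit step along a subgradient stays in the compact unit neighbourhood of \<open>C\<close>, on which \<open>P\<close> is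
  bounded.\<close>

lemma subgrad_bounded:
  fixes P :: "'a::euclidean_space \<Rightarrow> real"
  assumes P: "convex_on UNIV P" and C: "compact C"
  shows "bdd_above {norm \<xi> | \<xi> x. x \<in> C \<and> \<xi> \<in> subdiff P x}"
proof -
  define D where "D = {x + y | x y. x \<in> C \<and> y \<in> cball 0 1}"
  have "compact D" unfolding D_def by (intro compact_sums C compact_cball)
  then have "bounded (P ` D)"
    by (intro compact_imp_bounded compact_continuous_image convex_on_imp_continuous_on P)
  then obtain B where B: "\<And>z. z \<in> D \<Longrightarrow> \<bar>P z\<bar> \<le> B"
    by (auto simp: bounded_iff)
  have "norm \<xi> \<le> 2 * B" if x: "x \<in> C" and xi: "\<xi> \<in> subdiff P x" for \<xi> x
  proof -
    define z where "z = x + sgn \<xi>"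
    have zD: "z \<in> D" unfolding D_def z_def
      using x by (intro CollectI exI[of _ x] exI[of _ "sgn \<xi>"]) (simp add: norm_sgn)
    have xD: "x \<in> D" unfolding D_def using x by force
    have "\<xi> \<bullet> sgn \<xi> = norm \<xi>"
      by (cases "\<xi> = 0")
         (simp_all add: sgn_div_norm power2_norm_eq_inner[symmetric] power2_eq_square)
    then have "P x + norm \<xi> \<le> P z"
      using xi by (auto simp: subdiff_def z_def dest: spec[of _ "x + sgn \<xi>"])
    with B[OF zD] B[OF xD] show ?thesis by linarith
  qed
  then show ?thesis by (auto intro!: bdd_aboveI[of _ "2 * B"])
qed

lemma norm_subgrad_le_bound:
  assumes "convex_on UNIV P" "compact C" "x \<in> C" "\<xi> \<in> subdiff P x"
  shows "norm \<xi> \<le> subgrad_bound P C"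
  unfolding subgrad_bound_def
  using assms by (intro cSup_upper subgrad_bounded) auto

lemma norm_grad_le_bound:
  fixes f :: "'a::euclidean_space \<Rightarrow> real"
  assumes "C1 f" "compact C" "x \<in> C"
  shows "norm (grad f x) \<le> grad_bound f C"
proof -
  have "continuous_on C (deriv_op f)"
    using assms(1) by (auto simp: C1_def intro: continuous_on_subset)
  then have "bounded (deriv_op f ` C)"
    by (intro compact_imp_bounded compact_continuous_image assms)
  then obtain B where "\<And>z. z \<in> C \<Longrightarrow> norm (deriv_op f z) \<le> B"
    by (auto simp: bounded_iff)
  then have "norm (grad f z) \<le> B" if "z \<in> C" for z
    using norm_grad_le_norm_deriv_op[OF C1_differentiable[OF assms(1)], of z] that by force
  then show ?thesis
    unfolding grad_bound_def using assms(3) by (intro cSUP_upper bdd_aboveI) auto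
qed


section \<open>Optimality over a convex set\<close>

text \<open>The quadratic term contributes only its linearisation at the minimiser: comparing \<open>x\<close> with
  \<open>x + s *\<^sub>R (y - x)\<close>, its remainder is quadratic in \<open>s\<close> and vanishes after division by \<open>s\<close>.\<close>

lemma minimizer_linear_variational:
  fixes P :: "'a::euclidean_space \<Rightarrow> real"
  assumes P: "convex_on UNIV P" and C: "convex C" "x \<in> C" "y \<in> C"
    and min: "\<And>y. y \<in> C \<Longrightarrow>
      P x + a \<bullet> x + k / 2 * (norm (x - x0))\<^sup>2 \<le> P y + a \<bullet> y + k / 2 * (norm (y - x0))\<^sup>2"
  shows "P x \<le> P y + (a + k *\<^sub>R (x - x0)) \<bullet> (y - x)"
proof -
  let ?d = "y - x" and ?b = "k / 2 * (norm (y - x))\<^sup>2"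
  let ?R = "P y - P x + (a + k *\<^sub>R (x - x0)) \<bullet> ?d"
  have sq: "(norm (x + s *\<^sub>R ?d - x0))\<^sup>2
      = (norm (x - x0))\<^sup>2 + 2 * s * ((x - x0) \<bullet> ?d) + s\<^sup>2 * (norm ?d)\<^sup>2" for s
    unfolding power2_norm_eq_inner
    by (simp add: inner_add_left inner_add_right inner_diff_left inner_diff_right inner_commute
        power2_eq_square algebra_simps)
  have "- (s * ?b) \<le> ?R" if s: "0 < s" "s < 1" for s
  proof -
    have e: "x + s *\<^sub>R ?d = (1 - s) *\<^sub>R x + s *\<^sub>R y" by (simp add: algebra_simps)
    have "x + s *\<^sub>R ?d \<in> C"
      using convexD_alt[OF C, of s] s by (simp add: e)
    from min[OF this] have "P x \<le> P (x + s *\<^sub>R ?d) + s * (a \<bullet> ?d)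
        + s * (k * ((x - x0) \<bullet> ?d)) + s * s * ?b"
      unfolding sq by (simp add: inner_add_right algebra_simps power2_eq_square)
    also have "P (x + s *\<^sub>R ?d) \<le> (1 - s) * P x + s * P y"
      unfolding e using convex_onD[OF P, of s x y] s by simp
    finally have "0 \<le> s * (?R + s * ?b)"
      by (simp add: algebra_simps inner_add_left)
    then show ?thesis using s by (simp add: zero_le_mult_iff)
  qed
  then have ev: "eventually (\<lambda>s. - (s * ?b) \<le> ?R) (at_right (0::real))"
    unfolding eventually_at_right_field by (intro exI[of _ 1]) auto
  have "((\<lambda>s. - (s * ?b)) \<longlongrightarrow> - (0 * ?b)) (at_right (0::real))"
    by (intro tendsto_intros)
  from tendsto_upperbound[OF this ev] have "0 \<le> ?R" by simp
  then show ?thesis by simp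
qed

text \<open>The strong convexity of the subproblem gains the second quadratic term; it is what allows a trial
  constant as small as half of the smoothness constants in the line search.\<close>

lemma minimizer_quadratic_growth:
  fixes P :: "'a::euclidean_space \<Rightarrow> real"
  assumes "convex_on UNIV P" "convex C" "x \<in> C" "y \<in> C"
    and "\<And>y. y \<in> C \<Longrightarrow>
      P x + a \<bullet> x + k / 2 * (norm (x - x0))\<^sup>2 \<le> P y + a \<bullet> y + k / 2 * (norm (y - x0))\<^sup>2"
  shows "P x + a \<bullet> x + k / 2 * (norm (x - x0))\<^sup>2 + k / 2 * (norm (y - x))\<^sup>2
       \<le> P y + a \<bullet> y + k / 2 * (norm (y - x0))\<^sup>2"
proof -
  have sq: "(norm (y - x0))\<^sup>2 = (norm (x - x0))\<^sup>2 + 2 * ((x - x0) \<bullet> (y - x)) + (norm (y - x))\<^sup>2"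
    unfolding power2_norm_eq_inner
    by (simp add: inner_diff_left inner_diff_right inner_commute algebra_simps)
  show ?thesis
    using minimizer_linear_variational[OF assms]
    unfolding sq by (simp add: algebra_simps inner_add_left inner_diff_right inner_diff_left)
qed

text \<open>The sum rule for \<open>P\<close>, a linear function and the indicator of \<open>C\<close>: the strict epigraph of \<open>P\<close> is
  separated from the region over \<open>C\<close> below the affine minorant.  As \<open>P\<close> is finite everywhere, the
  separating hyperplane is not vertical and its slope is the subgradient.\<close>

lemma minimizer_subgradient:
  fixes P :: "'a::euclidean_space \<Rightarrow> real"
  assumes P: "convex_on UNIV P" and C: "convex C" "x \<in> C"
    and var: "\<And>y. y \<in> C \<Longrightarrow> P x \<le> P y + a \<bullet> (y - x)"
  obtains p where "p \<in> subdiff P x" "- (a + p) \<in> normal_cone C x"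
proof -
  define E where "E = {(y, r). P y < r}"
  define T where "T = {(y, r). y \<in> C \<and> r \<le> P x - a \<bullet> (y - x)}"
  have "convex E"
  proof (rule convexI)
    fix u v :: "'a \<times> real" and s t :: real
    assume uv: "u \<in> E" "v \<in> E" and st: "0 \<le> s" "0 \<le> t" "s + t = 1"
    have "P (s *\<^sub>R fst u + t *\<^sub>R fst v) \<le> s * P (fst u) + t * P (fst v)"
      using P st unfolding convex_on_def by blast
    also have "\<dots> < s * snd u + t * snd v"
    proof (cases "s = 0")
      case True
      then show ?thesis using uv st by (auto simp: E_def)
    next
      case False
      then have "s * P (fst u) < s * snd u" using uv st by (auto simp: E_def)
      moreover have "t * P (fst v) \<le> t * snd v"
        using uv st by (auto simp: E_def intro!: mult_left_mono)
      ultimately show ?thesis by simp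
    qed
    finally show "s *\<^sub>R u + t *\<^sub>R v \<in> E"
      by (auto simp: E_def case_prod_beta)
  qed
  moreover have "convex T"
  proof (rule convexI)
    fix u v :: "'a \<times> real" and s t :: real
    assume uv: "u \<in> T" "v \<in> T" and st: "0 \<le> s" "0 \<le> t" "s + t = 1"
    have "s * snd u + t * snd v
        \<le> s * (P x - a \<bullet> (fst u - x)) + t * (P x - a \<bullet> (fst v - x))"
      using uv st by (auto simp: T_def intro!: add_mono mult_left_mono)
    also have "\<dots> = (s + t) * P x - a \<bullet> (s *\<^sub>R fst u + t *\<^sub>R fst v - (s + t) *\<^sub>R x)"
      by (simp add: algebra_simps inner_diff_right inner_add_right)
    finally show "s *\<^sub>R u + t *\<^sub>R v \<in> T"
      using uv st convexD[OF C(1), of "fst u" "fst v" s t]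
      by (auto simp: T_def case_prod_beta)
  qed
  moreover have "E \<noteq> {}" using lt_ex[of "P x"] by (auto simp: E_def intro!: exI[of _ x] gt_ex)
  moreover have "T \<noteq> {}" using C by (auto simp: T_def)
  moreover have "T \<inter> E = {}" using var by (force simp: E_def T_def)
  ultimately obtain w b where w: "w \<noteq> 0" "\<forall>u\<in>T. w \<bullet> u \<le> b" "\<forall>u\<in>E. b \<le> w \<bullet> u"
    using separating_hyperplane_sets[of T E] by blast
  obtain q \<beta> where wq: "w = (q, \<beta>)" by (cases w)
  have TE: "q \<bullet> y + \<beta> * r \<le> q \<bullet> z + \<beta> * s"
    if "y \<in> C" "r \<le> P x - a \<bullet> (y - x)" "P z < s" for y r z s
  proof -
    have "(y, r) \<in> T" "(z, s) \<in> E" using that by (auto simp: T_def E_def)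
    then show ?thesis using w(2,3) unfolding wq by fastforce
  qed
  have "\<beta> \<ge> 0"
    using TE[of x "P x" x "P x + 1"] C by (simp add: algebra_simps)
  moreover have "\<beta> \<noteq> 0"
  proof
    assume "\<beta> = 0"
    with TE[of x "P x" "x - q" "P (x - q) + 1"] C have "q \<bullet> q \<le> 0"
      by (simp add: inner_diff_right)
    then have "q = 0" by (metis inner_eq_zero_iff inner_ge_zero order_antisym)
    with w(1) \<open>\<beta> = 0\<close> show False by (simp add: wq zero_prod_def)
  qed
  ultimately have beta: "\<beta> > 0" by simp
  have TE': "q \<bullet> y + \<beta> * (P x - a \<bullet> (y - x)) \<le> q \<bullet> z + \<beta> * P z" if "y \<in> C" for y z
  proof (rule field_le_epsilon)
    fix e :: real assume "0 < e"
    then show "q \<bullet> y + \<beta> * (P x - a \<bullet> (y - x)) \<le> q \<bullet> z + \<beta> * P z + e"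
      using TE[OF that order_refl, of z "P z + e / \<beta>"] beta by (simp add: distrib_left)
  qed
  define p where "p = - (1 / \<beta>) *\<^sub>R q"
  have q: "q = - (\<beta> *\<^sub>R p)" using beta by (simp add: p_def)
  have "P z \<ge> P x + p \<bullet> (z - x)" for z
  proof -
    have "\<beta> * (P x + p \<bullet> (z - x)) \<le> \<beta> * P z"
      using TE'[OF C(2), of z] by (simp add: q algebra_simps inner_diff_right)
    then show ?thesis using beta by simp
  qed
  moreover have "- (a + p) \<bullet> (z - x) \<le> 0" if "z \<in> C" for z
  proof -
    have "\<beta> * (- (a + p) \<bullet> (z - x)) \<le> 0"
      using TE'[OF that, of x] by (simp add: q algebra_simps inner_diff_right inner_add_left)
    then show ?thesis using beta by (simp add: mult_le_0_iff)
  qed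
  ultimately show ?thesis
    using C by (intro that[of p]) (auto simp: subdiff_def normal_cone_def)
qed


section \<open>Directions within the feasible set\<close>

text \<open>The linear space parallel to the affine hull of \<open>C\<close>, in a form that singles out no point of \<open>C\<close>.\<close>

definition direction_space :: "'a::euclidean_space set \<Rightarrow> 'a set" where
  "direction_space C = span {y - x | x y. x \<in> C \<and> y \<in> C}"

lemma diff_in_direction_space: "x \<in> C \<Longrightarrow> y \<in> C \<Longrightarrow> y - x \<in> direction_space C"
  unfolding direction_space_def by (intro span_base) blast

text \<open>Vectors orthogonal to the direction space may be added to any normal vector.  Hence a residual that is
  small against directions of \<open>C\<close> becomes small in norm after changing its normal part.\<close>

lemma normal_cone_absorbs:
  assumes v: "v \<in> normal_cone C x" and B: "0 \<le> B"
    and w: "\<And>d. d \<in> direction_space C \<Longrightarrow> w \<bullet> d \<le> B * norm d"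
  obtains v' where "v' \<in> normal_cone C x" "norm (w + (v' - v)) \<le> B"
proof -
  obtain s e where se: "s \<in> direction_space C" "\<And>d. d \<in> direction_space C \<Longrightarrow> orthogonal e d"
      "w = s + e"
    using orthogonal_subspace_decomp_exists[of "{y - x | x y. x \<in> C \<and> y \<in> C}" w]
    unfolding direction_space_def by blast
  have "s \<bullet> s \<le> B * norm s"
    using w[OF se(1)] se(2)[OF se(1)] by (simp add: se(3) inner_add_left orthogonal_def)
  then have "norm s \<le> B" using B by (rule norm_le_of_inner_le)
  moreover have "v - e \<in> normal_cone C x"
    using v se(2)[OF diff_in_direction_space[of x C]]
    by (auto simp: normal_cone_def inner_diff_left orthogonal_def split: if_splits)
  ultimately show ?thesis using se(3) by (intro that[of "v - e"]) auto
qed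

text \<open>At a relative interior point the difference quotients in the direction \<open>d\<close> stay in \<open>C\<close>, where the
  Lipschitz bound applies; the remaining points are limits of relative interior points.\<close>

lemma frechet_derivative_direction_bound:
  fixes c :: "'a::euclidean_space \<Rightarrow> 'b::euclidean_space"
  assumes c: "C1 c" and lip: "M-lipschitz_on C c" and C: "convex C" "x \<in> C"
    and d: "d \<in> direction_space C"
  shows "norm (frechet_derivative c (at x) d) \<le> M * norm d"
proof -
  let ?D = "\<lambda>x. frechet_derivative c (at x) d"
  have ri: "norm (?D z) \<le> M * norm d" if z: "z \<in> rel_interior C" for z
  proof -
    obtain e where e: "e > 0" "ball z e \<inter> affine hull C \<subseteq> C" and zC: "z \<in> C"
      using z mem_rel_interior_ball by blast
    have aff: "z + s *\<^sub>R d \<in> affine hull C" for s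
    proof -
      let ?Z = "span ((\<lambda>y. y - z) ` (C - {z}))"
      have "y - z \<in> ?Z" if "y \<in> C" for y
        using that by (cases "y = z") (auto intro: span_zero span_base)
      then have "(v - z) - (u - z) \<in> ?Z" if "u \<in> C" "v \<in> C" for u v
        using that by (metis span_diff)
      then have "{y - x | x y. x \<in> C \<and> y \<in> C} \<subseteq> ?Z" by auto
      then have "d \<in> ?Z"
        using d span_minimal[OF _ subspace_span] unfolding direction_space_def by blast
      then have "s *\<^sub>R d \<in> ?Z" by (rule span_scale)
      then show ?thesis using affine_hull_span2[OF zC] by auto
    qed
    have D: "(c has_derivative frechet_derivative c (at z)) (at z)"
      using C1_differentiable[OF c] frechet_derivative_works by blast
    show ?thesis
    proof (rule field_le_epsilon)
      fix \<delta> :: real assume \<delta>: "\<delta> > 0"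
      define e' where "e' = \<delta> / (norm d + 1)"
      have e': "e' > 0" "e' * norm d \<le> \<delta>"
        using \<delta> by (auto simp: e'_def field_simps add_pos_nonneg)
      obtain r where r: "r > 0" "\<And>y. norm (y - z) < r \<Longrightarrow>
          norm (c y - c z - frechet_derivative c (at z) (y - z)) \<le> e' * norm (y - z)"
        using D e' unfolding has_derivative_at_alt by metis
      define m where "m = min e r"
      define s where "s = m / (norm d + 1)"
      have m: "m > 0" using e r by (simp add: m_def)
      have s: "s > 0" "s * norm d < m"
        using m by (auto simp: s_def field_simps add_pos_nonneg)
      then have sd: "s * norm d < e" "s * norm d < r" by (auto simp: m_def)
      let ?y = "z + s *\<^sub>R d"
      have yC: "?y \<in> C"
        using e(2) aff[of s] s sd by (auto simp: dist_norm subset_iff)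
      have "s * norm (?D z) = norm (frechet_derivative c (at z) (?y - z))"
        using s by (simp add: linear_cmul[OF has_derivative_linear[OF D]])
      also have "\<dots> \<le> norm (c ?y - c z) + e' * norm (?y - z)"
        using r(2)[of ?y] s sd
          norm_triangle_sub[of "frechet_derivative c (at z) (?y - z)" "c ?y - c z"]
        by (simp add: norm_minus_commute)
      also have "norm (c ?y - c z) \<le> M * norm (?y - z)"
        using lipschitz_onD[OF lip yC zC] by (simp add: dist_norm)
      finally have "s * norm (?D z) \<le> s * (M * norm d + e' * norm d)"
        using s by (simp add: algebra_simps)
      then show "norm (?D z) \<le> M * norm d + \<delta>" using s e' by simp
    qed
  qed
  have "closed {z. norm (?D z) \<le> M * norm d}"
    using c by (intro closed_Collect_le continuous_intros continuous_on_frechet_derivative_apply)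
  then have "closure (rel_interior C) \<subseteq> {z. norm (?D z) \<le> M * norm d}"
    using ri by (intro closure_minimal) auto
  moreover have "x \<in> closure (rel_interior C)"
    using C closure_subset by (auto simp: convex_closure_rel_interior)
  ultimately show ?thesis by blast
qed

section \<open>The smoothed constraint\<close>

locale smoothed_constraint =
  fixes C :: "'a::euclidean_space set"
    and c :: "'a \<Rightarrow> 'b::euclidean_space"
    and h :: "'b \<Rightarrow> real"
    and hs :: "real \<Rightarrow> 'b \<Rightarrow> real"
    and \<phi>s :: "real \<Rightarrow> real \<Rightarrow> real"
    and L\<^sub>c M\<^sub>c M\<^sub>h \<alpha>1h \<alpha>2h \<alpha>31h \<alpha>32h \<alpha>4h \<alpha>1\<phi> \<alpha>2\<phi> \<alpha>31\<phi> \<alpha>32\<phi> \<alpha>4\<phi> :: real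
  assumes compact_C: "compact C" and convex_C: "convex C"
    and C1_c: "C1 c" and smooth_c: "smooth_on L\<^sub>c C c" and lip_c: "M\<^sub>c-lipschitz_on C c"
    and lip_h: "M\<^sub>h-lipschitz_on UNIV h"
    and sa_h: "smoothing_approx h hs \<alpha>1h \<alpha>2h \<alpha>31h \<alpha>32h" and mono_h: "smoothing_mono hs \<alpha>4h"
    and sa_\<phi>: "smoothing_approx pos_part \<phi>s \<alpha>1\<phi> \<alpha>2\<phi> \<alpha>31\<phi> \<alpha>32\<phi>"
    and mono_\<phi>: "smoothing_mono \<phi>s \<alpha>4\<phi>"
begin

abbreviation G :: "real \<Rightarrow> 'a \<Rightarrow> real" where
  "G \<equiv> g_smooth hs \<phi>s c"

text \<open>A Lipschitz constant for the gradient of \<open>G \<mu>\<close> along directions of \<open>C\<close>.\<close>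

definition lip_grad :: "real \<Rightarrow> real" where
  "lip_grad \<mu> = M\<^sub>h * L\<^sub>c + (\<alpha>1h + M\<^sub>h\<^sup>2 * \<alpha>1\<phi>) * M\<^sub>c\<^sup>2 + (\<alpha>2h + M\<^sub>h\<^sup>2 * \<alpha>2\<phi>) * M\<^sub>c\<^sup>2 / \<mu>"

lemma const_nonneg:
  "0 \<le> M\<^sub>h" "0 \<le> M\<^sub>c" "0 \<le> L\<^sub>c" "0 \<le> \<alpha>1h" "0 < \<alpha>2h" "0 \<le> \<alpha>1\<phi>" "0 < \<alpha>2\<phi>"
  "0 < \<alpha>31h + \<alpha>32h" "0 < \<alpha>31\<phi> + \<alpha>32\<phi>" "0 \<le> \<alpha>4h" "0 \<le> \<alpha>4\<phi>"
  using lip_h lip_c smooth_c sa_h sa_\<phi> mono_h mono_\<phi>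
  by (auto simp: smooth_on_def smoothing_approx_def smoothing_mono_def dest: lipschitz_on_nonneg)

context
  fixes \<mu> :: real
  assumes mu: "\<mu> > 0"
begin

lemma diff_hs: "hs \<mu> differentiable (at y)"
  using sa_h mu by (auto simp: smoothing_approx_def intro: C1_differentiable)

lemma diff_\<phi>s: "\<phi>s \<mu> differentiable (at s)"
  using sa_\<phi> mu by (auto simp: smoothing_approx_def intro: C1_differentiable)

lemma hs_bounds: "h y - \<alpha>31h * \<mu> \<le> hs \<mu> y" "hs \<mu> y \<le> h y + \<alpha>32h * \<mu>"
  using sa_h mu by (auto simp: smoothing_approx_def)

lemma \<phi>s_bounds: "pos_part s - \<alpha>31\<phi> * \<mu> \<le> \<phi>s \<mu> s" "\<phi>s \<mu> s \<le> pos_part s + \<alpha>32\<phi> * \<mu>"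
  using sa_\<phi> mu by (auto simp: smoothing_approx_def)

lemma grad_hs_eps_subdiff: "grad (hs \<mu>) y \<in> eps_subdiff ((\<alpha>31h + \<alpha>32h) * \<mu>) h y"
  using grad_smoothing_in_eps_subdiff[OF sa_h mu] .

lemma norm_grad_hs_le: "norm (grad (hs \<mu>) y) \<le> M\<^sub>h"
  using norm_eps_subdiff_le[OF lip_h grad_hs_eps_subdiff] .

lemma grad_\<phi>s_bounds: "0 \<le> grad (\<phi>s \<mu>) s" "grad (\<phi>s \<mu>) s \<le> 1"
  using eps_subdiff_pos_part[OF grad_smoothing_in_eps_subdiff[OF sa_\<phi> mu]] by auto

lemma hs_tangent: "hs \<mu> z \<ge> hs \<mu> y + grad (hs \<mu>) y \<bullet> (z - y)"
  using grad_convex_in_subdiff[OF _ diff_hs] sa_h mu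
  by (auto simp: smoothing_approx_def subdiff_def)

lemma \<phi>s_tangent: "\<phi>s \<mu> z \<ge> \<phi>s \<mu> s + grad (\<phi>s \<mu>) s * (z - s)"
  using grad_convex_in_subdiff[OF _ diff_\<phi>s] sa_\<phi> mu
  by (auto simp: smoothing_approx_def subdiff_def)

lemma hs_lipschitz: "\<bar>hs \<mu> y - hs \<mu> z\<bar> \<le> M\<^sub>h * norm (y - z)"
proof -
  have *: "hs \<mu> y - hs \<mu> z \<le> M\<^sub>h * norm (y - z)" for y z
  proof -
    have "hs \<mu> y - hs \<mu> z \<le> grad (hs \<mu>) y \<bullet> (y - z)"
      using hs_tangent[of y z] by (simp add: inner_diff_right)
    also have "\<dots> \<le> norm (grad (hs \<mu>) y) * norm (y - z)" by (rule norm_cauchy_schwarz)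
    also have "\<dots> \<le> M\<^sub>h * norm (y - z)" by (intro mult_right_mono norm_grad_hs_le) simp
    finally show ?thesis .
  qed
  show ?thesis using *[of y z] *[of z y] by (simp add: abs_le_iff norm_minus_commute)
qed

lemma has_derivative_G:
  "(G \<mu> has_derivative (\<lambda>d. (grad (\<phi>s \<mu>) (hs \<mu> (c x)) *\<^sub>R
       adjoint (frechet_derivative c (at x)) (grad (hs \<mu>) (c x))) \<bullet> d)) (at x)"
proof -
  have c: "(c has_derivative frechet_derivative c (at x)) (at x)"
    using C1_differentiable[OF C1_c] frechet_derivative_works by blast
  have adj: "adjoint (frechet_derivative c (at x)) w \<bullet> d = w \<bullet> frechet_derivative c (at x) d" for w d
    using adjoint_works[OF has_derivative_linear[OF c], of d w] by (simp add: inner_commute)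
  have "(G \<mu> has_derivative (\<lambda>d. grad (\<phi>s \<mu>) (hs \<mu> (c x)) \<bullet>
       (grad (hs \<mu>) (c x) \<bullet> frechet_derivative c (at x) d))) (at x)"
    unfolding g_smooth_def
    by (intro has_derivative_compose[OF has_derivative_compose[OF c has_derivative_grad[OF diff_hs]]
        has_derivative_grad[OF diff_\<phi>s]])
  then show ?thesis
    by (simp add: adj)
qed

lemma diff_G: "G \<mu> differentiable (at x)"
  using has_derivative_G by (auto simp: differentiable_def)

lemma grad_G: "grad (G \<mu>) x = grad (\<phi>s \<mu>) (hs \<mu> (c x)) *\<^sub>R
       adjoint (frechet_derivative c (at x)) (grad (hs \<mu>) (c x))"
  by (rule grad_eqI[OF has_derivative_G])

text \<open>The product rule applied to \<open>\<phi>s'\<close>, the gradient of \<open>hs\<close> and the derivative of \<open>c\<close>.  The bound \<open>M\<^sub>c\<close> on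
  the last factor is available only against directions of \<open>C\<close>.\<close>

lemma grad_G_lipschitz:
  assumes x: "x \<in> C" and z: "z \<in> C" and d: "d \<in> direction_space C"
  shows "(grad (G \<mu>) z - grad (G \<mu>) x) \<bullet> d \<le> lip_grad \<mu> * norm (z - x) * norm d"
proof -
  define a where "a y = grad (\<phi>s \<mu>) (hs \<mu> (c y))" for y
  define u where "u y = grad (hs \<mu>) (c y)" for y
  define D where "D y = frechet_derivative c (at y) d" for y
  let ?l\<phi> = "\<alpha>1\<phi> + \<alpha>2\<phi> / \<mu>" and ?lh = "\<alpha>1h + \<alpha>2h / \<mu>" and ?n = "norm (z - x)"
  have l: "0 \<le> ?l\<phi>" "0 \<le> ?lh" using const_nonneg mu by auto
  have G: "grad (G \<mu>) y \<bullet> d = (a y *\<^sub>R u y) \<bullet> D y" for y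
  proof -
    have "linear (frechet_derivative c (at y))"
      using C1_differentiable[OF C1_c] by (rule linear_frechet_derivative)
    from adjoint_works[OF this] show ?thesis
      by (simp add: grad_G a_def u_def D_def inner_commute)
  qed
  have cn: "norm (c z - c x) \<le> M\<^sub>c * ?n"
    using lipschitz_onD[OF lip_c z x] by (simp add: dist_norm)
  have "\<bar>a z - a x\<bar> \<le> ?l\<phi> * \<bar>hs \<mu> (c z) - hs \<mu> (c x)\<bar>"
  proof -
    have "?l\<phi>-lipschitz_on UNIV (grad (\<phi>s \<mu>))"
      using sa_\<phi> mu by (auto simp: smoothing_approx_def)
    from lipschitz_onD[OF this] show ?thesis by (simp add: a_def dist_real_def)
  qed
  also have "\<dots> \<le> ?l\<phi> * (M\<^sub>h * (M\<^sub>c * ?n))"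
    using order_trans[OF hs_lipschitz mult_left_mono[OF cn const_nonneg(1)]]
    by (intro mult_left_mono l)
  finally have az: "\<bar>a z - a x\<bar> \<le> ?l\<phi> * (M\<^sub>h * (M\<^sub>c * ?n))" .
  have "norm (u z - u x) \<le> ?lh * norm (c z - c x)"
  proof -
    have "?lh-lipschitz_on UNIV (grad (hs \<mu>))"
      using sa_h mu by (auto simp: smoothing_approx_def)
    from lipschitz_onD[OF this] show ?thesis by (simp add: u_def dist_norm)
  qed
  also have "\<dots> \<le> ?lh * (M\<^sub>c * ?n)" by (intro mult_left_mono cn l)
  finally have uz: "norm (u z - u x) \<le> ?lh * (M\<^sub>c * ?n)" .
  have ab: "0 \<le> a y" "a y \<le> 1" "norm (u y) \<le> M\<^sub>h" for y
    using grad_\<phi>s_bounds norm_grad_hs_le by (auto simp: a_def u_def)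
  have "norm (a z *\<^sub>R u z - a x *\<^sub>R u x) = norm ((a z - a x) *\<^sub>R u z + a x *\<^sub>R (u z - u x))"
    by (simp add: algebra_simps)
  also have "\<dots> \<le> \<bar>a z - a x\<bar> * norm (u z) + a x * norm (u z - u x)"
    using norm_triangle_ineq[of "(a z - a x) *\<^sub>R u z" "a x *\<^sub>R (u z - u x)"] ab(1)[of x] by simp
  also have "\<dots> \<le> (?l\<phi> * (M\<^sub>h * (M\<^sub>c * ?n))) * M\<^sub>h + 1 * (?lh * (M\<^sub>c * ?n))"
    using az uz ab const_nonneg l by (intro add_mono mult_mono) auto
  finally have w: "norm (a z *\<^sub>R u z - a x *\<^sub>R u x)
      \<le> (?l\<phi> * (M\<^sub>h * (M\<^sub>c * ?n))) * M\<^sub>h + 1 * (?lh * (M\<^sub>c * ?n))" .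
  have "norm (a x *\<^sub>R u x) \<le> 1 * M\<^sub>h"
    using ab[of x] const_nonneg by (simp only: norm_scaleR) (intro mult_mono, auto)
  moreover have "norm (D z - D x) \<le> (L\<^sub>c * ?n) * norm d"
  proof -
    have "D z - D x = blinfun_apply (deriv_op c z - deriv_op c x) d"
      by (simp add: D_def minus_blinfun.rep_eq deriv_op_apply C1_differentiable[OF C1_c])
    also have "norm \<dots> \<le> norm (deriv_op c z - deriv_op c x) * norm d" by (rule norm_blinfun)
    also have "\<dots> \<le> (L\<^sub>c * ?n) * norm d"
      using smooth_c x z by (intro mult_right_mono) (auto simp: smooth_on_def dist_norm dest: lipschitz_onD)
    finally show ?thesis .
  qed
  ultimately have 2: "(a x *\<^sub>R u x) \<bullet> (D z - D x) \<le> (1 * M\<^sub>h) * ((L\<^sub>c * ?n) * norm d)"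
    using const_nonneg by (intro order_trans[OF norm_cauchy_schwarz] mult_mono) auto
  have "norm (D z) \<le> M\<^sub>c * norm d"
    unfolding D_def by (rule frechet_derivative_direction_bound[OF C1_c lip_c convex_C z d])
  with w have 1: "(a z *\<^sub>R u z - a x *\<^sub>R u x) \<bullet> D z
      \<le> ((?l\<phi> * (M\<^sub>h * (M\<^sub>c * ?n))) * M\<^sub>h + 1 * (?lh * (M\<^sub>c * ?n))) * (M\<^sub>c * norm d)"
    using const_nonneg l by (intro order_trans[OF norm_cauchy_schwarz] mult_mono) auto
  have "(grad (G \<mu>) z - grad (G \<mu>) x) \<bullet> d
      = (a z *\<^sub>R u z - a x *\<^sub>R u x) \<bullet> D z + (a x *\<^sub>R u x) \<bullet> (D z - D x)"
    by (simp only: inner_diff_left inner_diff_right G)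
  also have "\<dots> \<le> ((?l\<phi> * (M\<^sub>h * (M\<^sub>c * ?n))) * M\<^sub>h + 1 * (?lh * (M\<^sub>c * ?n))) * (M\<^sub>c * norm d)
      + (1 * M\<^sub>h) * ((L\<^sub>c * ?n) * norm d)"
    using 1 2 by (rule add_mono)
  also have "\<dots> = lip_grad \<mu> * ?n * norm d"
    by (simp add: lip_grad_def algebra_simps add_divide_distrib power2_eq_square)
  finally show ?thesis .
qed

lemma G_lower: "- \<alpha>31\<phi> * \<mu> \<le> G \<mu> x"
  using \<phi>s_bounds(1)[of "hs \<mu> (c x)"] by (simp add: g_smooth_def pos_part_def)

text \<open>By convexity the slope at \<open>s\<close> is at least the mean slope between \<open>0\<close> and \<open>s\<close>, which falls short of \<open>1\<close> by
  at most \<open>(\<alpha>31\<phi> + \<alpha>32\<phi>) * \<mu> / s\<close>.  This is why the algorithm tests against twice that constant.\<close>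

lemma grad_\<phi>s_ge_half:
  assumes "s > 2 * (\<alpha>31\<phi> + \<alpha>32\<phi>) * \<mu>"
  shows "grad (\<phi>s \<mu>) s \<ge> 1 / 2"
proof -
  have "0 < (\<alpha>31\<phi> + \<alpha>32\<phi>) * \<mu>" using const_nonneg mu by simp
  with assms have s: "s > 0" by (simp add: algebra_simps)
  have "\<phi>s \<mu> s \<le> \<phi>s \<mu> 0 + grad (\<phi>s \<mu>) s * s"
    using \<phi>s_tangent[of s 0] by simp
  moreover have "s - \<alpha>31\<phi> * \<mu> \<le> \<phi>s \<mu> s" "\<phi>s \<mu> 0 \<le> \<alpha>32\<phi> * \<mu>"
    using \<phi>s_bounds(1)[of s] \<phi>s_bounds(2)[of 0] s by (auto simp: pos_part_def)
  ultimately have "s / 2 \<le> grad (\<phi>s \<mu>) s * s"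
    using assms by (simp add: algebra_simps)
  then show ?thesis using s by simp
qed

text \<open>Complementarity at strictly feasible points: far inside, the slope of the smoothed positive part has
  to be small, since its total decrease to the left of \<open>0\<close> is bounded.\<close>

lemma grad_\<phi>s_neg:
  assumes "s < 0"
  shows "grad (\<phi>s \<mu>) s * (- s) \<le> (\<alpha>31\<phi> + \<alpha>32\<phi>) * \<mu>"
  using \<phi>s_tangent[of s 0] \<phi>s_bounds(1)[of s] \<phi>s_bounds(2)[of 0] assms
  by (simp add: pos_part_def algebra_simps)

end

text \<open>The error of the inner smoothing passes through the outer one undiminished but not amplified, as the
  slopes of \<open>\<phi>s\<close> lie between \<open>0\<close> and \<open>1\<close>.\<close>

lemma G_mono:
  assumes "0 < \<mu>1" "\<mu>1 \<le> \<mu>2"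
  shows "G \<mu>1 x \<le> G \<mu>2 x + (\<alpha>4h + \<alpha>4\<phi>) * (\<mu>2 - \<mu>1)"
proof -
  let ?s = "hs \<mu>1 (c x)" and ?e = "\<alpha>4h * (\<mu>2 - \<mu>1)"
  let ?t = "hs \<mu>2 (c x)"
  have e: "?s \<le> ?t + ?e" using mono_h assms by (simp add: smoothing_mono_def)
  have "\<phi>s \<mu>1 ?s \<le> \<phi>s \<mu>1 ?t + grad (\<phi>s \<mu>1) ?s * (?s - ?t)"
    using \<phi>s_tangent[OF assms(1), of ?s ?t] by (simp add: algebra_simps)
  also have "grad (\<phi>s \<mu>1) ?s * (?s - ?t) \<le> grad (\<phi>s \<mu>1) ?s * ?e"
    using e grad_\<phi>s_bounds[OF assms(1)] by (intro mult_left_mono) auto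
  also have "\<dots> \<le> 1 * ?e"
    using grad_\<phi>s_bounds[OF assms(1)] const_nonneg assms by (intro mult_right_mono) auto
  also have "\<phi>s \<mu>1 ?t \<le> \<phi>s \<mu>2 ?t + \<alpha>4\<phi> * (\<mu>2 - \<mu>1)"
    using mono_\<phi> assms by (simp add: smoothing_mono_def)
  finally show ?thesis by (simp add: g_smooth_def algebra_simps)
qed

lemma lip_grad_nonneg: "\<mu> > 0 \<Longrightarrow> 0 \<le> lip_grad \<mu>"
  using const_nonneg by (simp add: lip_grad_def)

text \<open>Only the part of \<open>lip_grad \<mu>\<close> proportional to \<open>1 / \<mu>\<close> is singular at \<open>0\<close>, and the factor \<open>\<mu>\<close> cancels it;
  the line search constants are thus bounded uniformly in \<open>k\<close>.\<close>

lemma lip_grad_scaled_mono: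
  assumes "0 < \<mu>1" "\<mu>1 \<le> \<mu>2"
  shows "\<mu>1 * lip_grad \<mu>1 \<le> \<mu>2 * lip_grad \<mu>2"
proof -
  let ?A = "M\<^sub>h * L\<^sub>c + (\<alpha>1h + M\<^sub>h\<^sup>2 * \<alpha>1\<phi>) * M\<^sub>c\<^sup>2"
  have "\<mu> * lip_grad \<mu> = \<mu> * ?A + (\<alpha>2h + M\<^sub>h\<^sup>2 * \<alpha>2\<phi>) * M\<^sub>c\<^sup>2" if "\<mu> > 0" for \<mu>
    using that by (simp add: lip_grad_def field_simps)
  moreover have "\<mu>1 * ?A \<le> \<mu>2 * ?A"
    using assms const_nonneg by (intro mult_right_mono) auto
  ultimately show ?thesis using assms by simp
qed

end


section \<open>The constraint qualification\<close>

text \<open>Linearising \<open>c\<close> in the subgradient inequality gives a Frechet subgradient, for which constant sequences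
  suffice in the limiting construction.\<close>

lemma adjoint_derivative_in_limiting_subdiff:
  fixes c :: "'a::euclidean_space \<Rightarrow> 'b::euclidean_space"
  assumes c: "c differentiable (at x)" and u: "u \<in> subdiff h (c x)"
  shows "adjoint (frechet_derivative c (at x)) u \<in> limiting_subdiff (\<lambda>y. h (c y)) x"
proof -
  let ?D = "frechet_derivative c (at x)"
  have D: "(c has_derivative ?D) (at x)" using c frechet_derivative_works by blast
  have adj: "adjoint ?D u \<bullet> v = u \<bullet> ?D v" for v
    using adjoint_works[OF has_derivative_linear[OF D], of v u] by (simp add: inner_commute)
  have "adjoint ?D u \<in> frechet_subdiff (\<lambda>y. h (c y)) x"
    unfolding frechet_subdiff_def
  proof (intro CollectI allI impI)
    fix e :: real assume e: "e > 0"
    define e' where "e' = e / (norm u + 1)"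
    have e': "e' > 0" "norm u * e' \<le> e"
      using e by (auto simp: e'_def field_simps add_pos_nonneg intro: mult_left_mono)
    obtain d where d: "d > 0"
      "\<And>y. norm (y - x) < d \<Longrightarrow> norm (c y - c x - ?D (y - x)) \<le> e' * norm (y - x)"
      using D e' unfolding has_derivative_at_alt by metis
    have "h (c y) \<ge> h (c x) + adjoint ?D u \<bullet> (y - x) - e * norm (y - x)" if "norm (y - x) < d" for y
    proof -
      have "- (u \<bullet> (c y - c x - ?D (y - x))) \<le> norm u * norm (c y - c x - ?D (y - x))"
        using norm_cauchy_schwarz[of u "- (c y - c x - ?D (y - x))"]
        by (simp only: inner_minus_right norm_minus_cancel)
      also have "\<dots> \<le> norm u * (e' * norm (y - x))"
        by (intro mult_left_mono d that) simp
      also have "\<dots> \<le> e * norm (y - x)"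
        using mult_right_mono[OF e'(2), of "norm (y - x)"] by (simp add: mult.assoc)
      finally have "- (u \<bullet> (c y - c x) - adjoint ?D u \<bullet> (y - x)) \<le> e * norm (y - x)"
        by (simp only: inner_diff_right[of u "c y - c x"] adj)
      moreover have "h (c y) \<ge> h (c x) + u \<bullet> (c y - c x)" using u by (simp add: subdiff_def)
      ultimately show ?thesis by linarith
    qed
    then show "\<forall>\<^sub>F y in at x. h (c y) \<ge> h (c x) + adjoint ?D u \<bullet> (y - x) - e * norm (y - x)"
      unfolding eventually_at using d(1) by (auto simp: dist_norm)
  qed
  then show ?thesis
    unfolding limiting_subdiff_def
    by (intro CollectI exI[of _ "\<lambda>_. x"] exI[of _ "\<lambda>_. adjoint ?D u"]) auto
qed


text \<open>By compactness: failures of the bound for all \<open>1 / (n + 1)\<close> have a cluster point, at which the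
  approximate subgradients become exact and the constraint qualification is violated.  The normality of the
  limit is tested against points of \<open>C\<close>, so that no limit of adjoints has to be taken.\<close>

lemma cq_constant_exists:
  fixes c :: "'a::euclidean_space \<Rightarrow> 'b::euclidean_space"
  assumes C: "compact C" and c: "C1 c" and lip: "M-lipschitz_on UNIV h" and CQ: "CQ C h c"
  shows "\<exists>\<eta>. cq_constant C h c \<eta>"
proof (rule ccontr)
  assume none: "\<nexists>\<eta>. cq_constant C h c \<eta>"
  define e where "e n = 1 / real (Suc n)" for n
  have e: "e n > 0" for n by (simp add: e_def)
  have e0: "e \<longlonglongrightarrow> 0" unfolding e_def by (rule LIMSEQ_Suc[OF lim_1_over_n])
  let ?A = "\<lambda>x. adjoint (frechet_derivative c (at x))"
  have "\<exists>x u v. x \<in> C \<and> h (c x) \<ge> - e n \<and> u \<in> eps_subdiff (e n) h (c x) \<and>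
      v \<in> normal_cone C x \<and> norm (?A x u + v) < e n" for n
  proof -
    obtain x u where xu: "x \<in> C" "h (c x) \<ge> - e n" "u \<in> eps_subdiff (e n) h (c x)"
      "infdist 0 {?A x u + v | v. v \<in> normal_cone C x} < e n"
      using none e[of n] unfolding cq_constant_def by (meson not_le)
    have ne: "{?A x u + v | v. v \<in> normal_cone C x} \<noteq> {}"
      using xu(1) by (auto simp: normal_cone_def intro!: exI[of _ 0])
    have "\<exists>v \<in> normal_cone C x. norm (?A x u + v) < e n"
    proof (rule ccontr)
      assume "\<not> ?thesis"
      then have "e n \<le> infdist 0 {?A x u + v | v. v \<in> normal_cone C x}"
        unfolding infdist_notempty[OF ne] using ne by (intro cINF_greatest) (auto simp: not_less)
      with xu(4) show False by simp
    qed
    with xu show ?thesis by blast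
  qed
  then obtain x u v where xuv: "\<And>n. x n \<in> C" "\<And>n. h (c (x n)) \<ge> - e n"
      "\<And>n. u n \<in> eps_subdiff (e n) h (c (x n))" "\<And>n. v n \<in> normal_cone C (x n)"
      "\<And>n. norm (?A (x n) (u n) + v n) < e n"
    by metis
  have "\<forall>n. (x n, u n) \<in> C \<times> cball 0 M"
    using xuv(1) norm_eps_subdiff_le[OF lip xuv(3)] by auto
  moreover have "compact (C \<times> cball (0::'b) M)"
    by (intro compact_Times C compact_cball)
  ultimately obtain l s where l: "l \<in> C \<times> cball 0 M" and s: "strict_mono s"
    and lim: "((\<lambda>n. (x n, u n)) \<circ> s) \<longlonglongrightarrow> l"
    unfolding compact_def by (metis (no_types, lifting))
  define y w where "y = fst l" and "w = snd l"
  have yC: "y \<in> C" using l by (auto simp: y_def)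
  have X: "(\<lambda>n. x (s n)) \<longlonglongrightarrow> y" and U: "(\<lambda>n. u (s n)) \<longlonglongrightarrow> w"
    using tendsto_fst[OF lim] tendsto_snd[OF lim] by (simp_all add: y_def w_def o_def)
  have E: "(\<lambda>n. e (s n)) \<longlonglongrightarrow> 0"
    using LIMSEQ_subseq_LIMSEQ[OF e0 s] by (simp add: o_def)
  have cx: "(\<lambda>n. c (x (s n))) \<longlonglongrightarrow> c y"
    using C1_continuous_on[OF c, of UNIV] X
    by (auto intro: continuous_on_tendsto_compose)
  have hx: "(\<lambda>n. h (c (x (s n)))) \<longlonglongrightarrow> h (c y)"
    using lipschitz_on_continuous_on[OF lip] cx
    by (auto intro: continuous_on_tendsto_compose)
  have Dx: "(\<lambda>n. deriv_op c (x (s n))) \<longlonglongrightarrow> deriv_op c y"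
    using c X by (auto simp: C1_def intro: continuous_on_tendsto_compose)
  have "h (c y) \<ge> 0"
    using tendsto_le[OF _ hx tendsto_minus[OF E]] xuv(2) by simp
  moreover have "w \<in> subdiff h (c y)"
    unfolding subdiff_def
  proof (intro CollectI allI)
    fix z
    have "(\<lambda>n. h (c (x (s n))) + u (s n) \<bullet> (z - c (x (s n))) - e (s n))
        \<longlonglongrightarrow> h (c y) + w \<bullet> (z - c y) - 0"
      by (intro tendsto_intros hx U cx E)
    then have "h (c y) + w \<bullet> (z - c y) - 0 \<le> h z"
      by (rule LIMSEQ_le_const2) (use xuv(3) in \<open>auto simp: eps_subdiff_def\<close>)
    then show "h (c y) + w \<bullet> (z - c y) \<le> h z" by simp
  qed
  then have "?A y w \<in> limiting_subdiff (\<lambda>y. h (c y)) y"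
    by (rule adjoint_derivative_in_limiting_subdiff[OF C1_differentiable[OF c]])
  moreover have "- ?A y w \<in> normal_cone C y"
  proof -
    have adj: "?A y w \<bullet> d = w \<bullet> blinfun_apply (deriv_op c y) d" for y w d
      using adjoint_works[OF linear_frechet_derivative[OF C1_differentiable[OF c]], of d y w]
      by (simp add: inner_commute deriv_op_apply[OF C1_differentiable[OF c]])
    have "0 \<le> ?A y w \<bullet> (z - y)" if z: "z \<in> C" for z
    proof -
      have "- e n * norm (z - x n) \<le> u n \<bullet> blinfun_apply (deriv_op c (x n)) (z - x n)" for n
      proof -
        have "- ((?A (x n) (u n) + v n) \<bullet> (z - x n)) \<le> e n * norm (z - x n)"
          using norm_cauchy_schwarz[of "- (?A (x n) (u n) + v n)" "z - x n"]
            mult_right_mono[OF less_imp_le[OF xuv(5)[of n]] norm_ge_zero[of "z - x n"]]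
          by (simp only: inner_minus_left norm_minus_cancel)
        moreover have "v n \<bullet> (z - x n) \<le> 0"
          using xuv(1,4)[of n] z by (simp add: normal_cone_def)
        ultimately show ?thesis by (simp only: adj inner_add_left)
      qed
      moreover have "(\<lambda>n. - e (s n) * norm (z - x (s n))) \<longlonglongrightarrow> - 0 * norm (z - y)"
        by (intro tendsto_intros E X)
      moreover have "(\<lambda>n. u (s n) \<bullet> blinfun_apply (deriv_op c (x (s n))) (z - x (s n)))
          \<longlonglongrightarrow> w \<bullet> blinfun_apply (deriv_op c y) (z - y)"
        by (intro tendsto_intros U X Dx)
      ultimately have "- 0 * norm (z - y) \<le> w \<bullet> blinfun_apply (deriv_op c y) (z - y)"
        by (intro LIMSEQ_le) auto
      then show ?thesis by (simp add: adj)
    qed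
    then show ?thesis using yC by (simp add: normal_cone_def)
  qed
  moreover have "0 = ?A y w + - ?A y w" by simp
  ultimately show False using CQ yC unfolding CQ_def by blast
qed

section \<open>A single iteration\<close>

lemma sub_solution_iff:
  fixes C :: "'a::euclidean_space set"
  assumes "C \<noteq> {}"
  shows "sub_solution f P1 C G \<gamma> \<mu> xk \<xi> L y \<longleftrightarrow> y \<in> C \<and>
    (\<forall>z\<in>C. \<gamma> * P1 y + (\<gamma> *\<^sub>R (grad f xk - \<xi>) + grad G xk) \<bullet> y + L / \<mu> / 2 * (norm (y - xk))\<^sup>2
          \<le> \<gamma> * P1 z + (\<gamma> *\<^sub>R (grad f xk - \<xi>) + grad G xk) \<bullet> z + L / \<mu> / 2 * (norm (z - xk))\<^sup>2)"
    (is "_ \<longleftrightarrow> y \<in> C \<and> (\<forall>z\<in>C. ?q y \<le> ?q z)")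
proof -
  \<comment> \<open>the part of the model that does not depend on the trial point\<close>
  define b where "b = G xk - grad G xk \<bullet> xk"
  have q: "sub_objective f P1 C G \<gamma> \<mu> xk \<xi> L z = (if z \<in> C then ereal (?q z + b) else \<infinity>)" for z
    by (simp add: sub_objective_def indicator_fn_def b_def algebra_simps inner_add_left
        inner_diff_left inner_diff_right)
  obtain z0 where z0: "z0 \<in> C" using assms by auto
  show ?thesis
    unfolding sub_solution_def is_arg_min_def q
    using z0 by (auto simp: not_less split: if_splits)
qed

lemma sub_solution_exists:
  fixes C :: "'a::euclidean_space set"
  assumes C: "compact C" "C \<noteq> {}" and P1: "convex_on UNIV P1"
  shows "\<exists>y. sub_solution f P1 C G \<gamma> \<mu> xk \<xi> L y"
proof -
  have "continuous_on C (\<lambda>y. \<gamma> * P1 y + (\<gamma> *\<^sub>R (grad f xk - \<xi>) + grad G xk) \<bullet> y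
      + L / \<mu> / 2 * (norm (y - xk))\<^sup>2)"
    by (intro continuous_intros convex_on_imp_continuous_on P1)
  from continuous_attains_inf[OF C this] show ?thesis
    unfolding sub_solution_iff[OF C(2)] by blast
qed

lemma decrease_test_iff:
  assumes "x \<in> C" "y \<in> C"
  shows "decrease_test (\<psi>_fn f P1 P2 C) G c1 \<gamma> \<mu> x y \<longleftrightarrow>
    \<gamma> * (f y + P1 y - P2 y) + G y
      \<le> \<gamma> * (f x + P1 x - P2 x) + G x - c1 / (2 * \<mu>) * (norm (y - x))\<^sup>2"
  using assms by (simp add: decrease_test_def \<psi>_fn_def indicator_fn_def)

lemma normal_cone_scaleR: "v \<in> normal_cone C x \<Longrightarrow> 0 \<le> s \<Longrightarrow> s *\<^sub>R v \<in> normal_cone C x"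
  by (auto simp: normal_cone_def mult_nonneg_nonpos split: if_splits)

locale sesqm = smoothed_constraint C c h hs \<phi>s L\<^sub>c M\<^sub>c M\<^sub>h \<alpha>1h \<alpha>2h \<alpha>31h \<alpha>32h \<alpha>4h \<alpha>1\<phi> \<alpha>2\<phi> \<alpha>31\<phi> \<alpha>32\<phi> \<alpha>4\<phi>
  for C :: "'a::euclidean_space set"
    and c :: "'a \<Rightarrow> 'b::euclidean_space"
    and h hs \<phi>s L\<^sub>c M\<^sub>c M\<^sub>h \<alpha>1h \<alpha>2h \<alpha>31h \<alpha>32h \<alpha>4h \<alpha>1\<phi> \<alpha>2\<phi> \<alpha>31\<phi> \<alpha>32\<phi> \<alpha>4\<phi> +
  fixes f P1 P2 :: "'a \<Rightarrow> real"
    and L\<^sub>f c1 c2 Llow Lup :: real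
    and \<gamma>hat \<mu> :: "nat \<Rightarrow> real"
    and x \<xi> :: "nat \<Rightarrow> 'a"
    and L0 L :: "nat \<Rightarrow> real"
    and t :: "nat \<Rightarrow> nat"
  assumes C1_f: "C1 f" and smooth_f: "smooth_on L\<^sub>f C f"
    and convex_P1: "convex_on UNIV P1" and convex_P2: "convex_on UNIV P2"
    and Llow: "0 < Llow" and c1: "0 < c1" and c2: "0 < c2"
    and \<gamma>hat_pos: "\<And>k. 0 < \<gamma>hat k" and \<gamma>hat_decr: "\<And>k. \<gamma>hat (Suc k) < \<gamma>hat k"
    and run: "sesqm_run f P1 P2 C c hs \<phi>s (\<alpha>31\<phi> + \<alpha>32\<phi>) c1 c2 Llow Lup \<gamma>hat \<mu> x \<xi> L0 L t"
begin

definition \<gamma> :: "nat \<Rightarrow> real" where "\<gamma> k = \<gamma>hat (t k)"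

definition \<Psi> :: "'a \<Rightarrow> real" where "\<Psi> y = f y + P1 y - P2 y"

definition M\<^sub>L :: real where "M\<^sub>L = max Lup (c1 + \<gamma>hat 0 * \<mu> 0 * L\<^sub>f + \<mu> 0 * lip_grad (\<mu> 0))"

definition step_updates :: "nat \<Rightarrow> bool" where
  "step_updates k \<longleftrightarrow> hs (\<mu> k) (c (x (Suc k))) > 2 * (\<alpha>31\<phi> + \<alpha>32\<phi>) * \<mu> k \<and>
     norm (x (Suc k) - x k) \<le> c2 * \<mu> k * \<gamma> k"

lemma \<mu>_pos: "0 < \<mu> k"
  using run by (cases k) (auto simp: sesqm_run_def)

lemma \<mu>_mono: "j \<le> k \<Longrightarrow> \<mu> k \<le> \<mu> j"
  using lift_Suc_antimono_le[of \<mu> j k] run by (auto simp: sesqm_run_def)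

lemma \<gamma>_pos: "0 < \<gamma> k"
  by (simp add: \<gamma>_def \<gamma>hat_pos)

lemma \<gamma>hat_antimono: "j \<le> k \<Longrightarrow> \<gamma>hat k \<le> \<gamma>hat j"
  using lift_Suc_antimono_le[of \<gamma>hat j k] \<gamma>hat_decr by (simp add: less_imp_le)

lemma \<gamma>_le: "\<gamma> k \<le> \<gamma>hat 0"
  by (simp add: \<gamma>_def \<gamma>hat_antimono)

lemma L\<^sub>f_nonneg: "0 \<le> L\<^sub>f"
  using smooth_f by (auto simp: smooth_on_def dest: lipschitz_on_nonneg)

lemma step:
  "sesqm_step f P1 P2 C c hs \<phi>s (\<alpha>31\<phi> + \<alpha>32\<phi>) c1 c2 (\<gamma> k) (\<mu> k)
            (x k) (\<xi> k) (L0 k) (L k) (x (Suc k)) (t k) (t (Suc k))"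
  using run by (simp add: sesqm_run_def \<gamma>_def)

lemma t_0: "t 0 = 0"
  using run by (simp add: sesqm_run_def)

lemma t_Suc: "t (Suc k) = (if step_updates k then Suc (t k) else t k)"
  using step[of k] by (simp add: sesqm_step_def step_updates_def Let_def)

lemma \<xi>_subdiff: "\<xi> k \<in> subdiff P2 (x k)"
  using run by (simp add: sesqm_run_def)

lemma L0_bounds: "0 < L0 k" "L0 k \<le> Lup"
  using run Llow by (auto simp: sesqm_run_def intro: less_le_trans)

lemma C_nonempty: "C \<noteq> {}"
  using run by (auto simp: sesqm_run_def)

lemma step_sub_solution: "sub_solution f P1 C (G (\<mu> k)) (\<gamma> k) (\<mu> k) (x k) (\<xi> k) (L k) (x (Suc k))"
  using step[of k] by (auto simp: sesqm_step_def Let_def)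

lemma x_in_C: "x k \<in> C"
  using run step_sub_solution[of "k - 1"]
  by (cases k) (auto simp: sesqm_run_def sub_solution_iff[OF C_nonempty])

lemma L_pos: "0 < L k"
  using step[of k] L0_bounds[of k] by (auto simp: sesqm_step_def Let_def)

lemma grad_f_lipschitz:
  assumes "y \<in> C" "z \<in> C"
  shows "norm (grad f y - grad f z) \<le> L\<^sub>f * norm (y - z)"
  using norm_grad_diff_le[of f y z] lipschitz_onD[OF smooth_f[unfolded smooth_on_def] assms]
    C1_differentiable[OF C1_f] by (force simp: dist_norm)

lemma grad_f_inner_lipschitz:
  assumes "y \<in> C" "z \<in> C"
  shows "(grad f y - grad f z) \<bullet> d \<le> L\<^sub>f * norm (y - z) * norm d"
  using norm_cauchy_schwarz[of "grad f y - grad f z" d]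
    mult_right_mono[OF grad_f_lipschitz[OF assms] norm_ge_zero[of d]] by linarith

text \<open>The descent inequalities for \<open>f\<close> and \<open>G\<close> and the subgradient inequality for \<open>P2\<close> replace the objective
  by its model, and the quadratic growth of the model at its minimiser pays for the error.\<close>

lemma decrease_test_if_large:
  assumes sol: "sub_solution f P1 C (G (\<mu> k)) (\<gamma> k) (\<mu> k) (x k) (\<xi> k) l y"
    and l: "c1 + \<gamma> k * \<mu> k * L\<^sub>f + \<mu> k * lip_grad (\<mu> k) \<le> 2 * l"
  shows "decrease_test (\<psi>_fn f P1 P2 C) (G (\<mu> k)) c1 (\<gamma> k) (\<mu> k) (x k) y"
proof -
  let ?G = "G (\<mu> k)" and ?g = "\<gamma> k" and ?m = "\<mu> k" and ?x = "x k"
  let ?n = "(norm (y - ?x))\<^sup>2" and ?a = "?g *\<^sub>R (grad f ?x - \<xi> k) + grad ?G ?x"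
  note m = \<mu>_pos[of k] and g = \<gamma>_pos[of k] and x = x_in_C[of k]
  have y: "y \<in> C" and min: "\<And>z. z \<in> C \<Longrightarrow> ?g * P1 y + ?a \<bullet> y + l / ?m / 2 * ?n
      \<le> ?g * P1 z + ?a \<bullet> z + l / ?m / 2 * (norm (z - ?x))\<^sup>2"
    using sol unfolding sub_solution_iff[OF C_nonempty] by auto
  have "convex_on UNIV (\<lambda>z. ?g * P1 z)"
    using convex_P1 g by (intro convex_on_cmul) auto
  from minimizer_quadratic_growth[OF this convex_C y x min]
  have 1: "?g * P1 y + ?a \<bullet> (y - ?x) + l / ?m * ?n \<le> ?g * P1 ?x"
    by (simp add: inner_diff_right norm_minus_commute)
  have "f y \<le> f ?x + grad f ?x \<bullet> (y - ?x) + L\<^sub>f / 2 * ?n"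
    by (rule descent_inequality[OF C1_differentiable[OF C1_f] convex_C x y])
       (rule grad_f_inner_lipschitz[OF _ x])
  then have 2: "?g * f y \<le> ?g * (f ?x + grad f ?x \<bullet> (y - ?x) + L\<^sub>f / 2 * ?n)"
    using g by (intro mult_left_mono) auto
  have 3: "?G y \<le> ?G ?x + grad ?G ?x \<bullet> (y - ?x) + lip_grad ?m / 2 * ?n"
    by (rule descent_inequality[OF diff_G[OF m] convex_C x y])
       (rule grad_G_lipschitz[OF m x _ diff_in_direction_space[OF x y]])
  have "P2 y \<ge> P2 ?x + \<xi> k \<bullet> (y - ?x)" using \<xi>_subdiff by (auto simp: subdiff_def)
  then have 4: "?g * P2 y \<ge> ?g * (P2 ?x + \<xi> k \<bullet> (y - ?x))" using g by (intro mult_left_mono) auto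
  have "(c1 + ?g * ?m * L\<^sub>f + ?m * lip_grad ?m) / (2 * ?m) * ?n \<le> 2 * l / (2 * ?m) * ?n"
    using l m by (intro mult_right_mono divide_right_mono) auto
  then have 5: "c1 / (2 * ?m) * ?n + ?g * (L\<^sub>f / 2 * ?n) + lip_grad ?m / 2 * ?n \<le> l / ?m * ?n"
    using m by (simp add: field_simps)
  show ?thesis
    unfolding decrease_test_iff[OF x y]
    using 1 2 3 4 5
    by (simp add: algebra_simps inner_add_left inner_diff_left)
qed

text \<open>A constant that was doubled had been rejected before doubling, so it was below the threshold of
  \<open>decrease_test_if_large\<close>.\<close>

lemma L_le: "L k \<le> M\<^sub>L"
proof -
  obtain i where i: "L k = 2 ^ i * L0 k"
    and rej: "\<And>j y. j < i \<Longrightarrow>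
      sub_solution f P1 C (G (\<mu> k)) (\<gamma> k) (\<mu> k) (x k) (\<xi> k) (2 ^ j * L0 k) y \<Longrightarrow>
      \<not> decrease_test (\<psi>_fn f P1 P2 C) (G (\<mu> k)) c1 (\<gamma> k) (\<mu> k) (x k) y"
    using step[of k] by (auto simp: sesqm_step_def Let_def)
  show ?thesis
  proof (cases i)
    case 0
    then show ?thesis using i L0_bounds[of k] by (simp add: M\<^sub>L_def)
  next
    case (Suc j)
    obtain y where "sub_solution f P1 C (G (\<mu> k)) (\<gamma> k) (\<mu> k) (x k) (\<xi> k) (2 ^ j * L0 k) y"
      using sub_solution_exists[OF compact_C C_nonempty convex_P1] by blast
    then have "2 * (2 ^ j * L0 k) < c1 + \<gamma> k * \<mu> k * L\<^sub>f + \<mu> k * lip_grad (\<mu> k)"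
      using rej[of j y] decrease_test_if_large[of k "2 ^ j * L0 k" y] Suc by (meson lessI not_le)
    moreover have "\<gamma> k * \<mu> k * L\<^sub>f \<le> \<gamma>hat 0 * \<mu> 0 * L\<^sub>f"
      using \<gamma>_le[of k] \<mu>_mono[of 0 k] \<gamma>_pos[of k] \<mu>_pos[of k] \<gamma>hat_pos[of 0] L\<^sub>f_nonneg
      by (intro mult_right_mono mult_mono) auto
    moreover have "\<mu> k * lip_grad (\<mu> k) \<le> \<mu> 0 * lip_grad (\<mu> 0)"
      by (intro lip_grad_scaled_mono \<mu>_pos \<mu>_mono) simp
    ultimately show ?thesis using i Suc by (simp add: M\<^sub>L_def)
  qed
qed

lemma step_decrease:
  "\<gamma> k * \<Psi> (x (Suc k)) + G (\<mu> k) (x (Suc k))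
     \<le> \<gamma> k * \<Psi> (x k) + G (\<mu> k) (x k) - c1 / (2 * \<mu> k) * (norm (x (Suc k) - x k))\<^sup>2"
  using step[of k] by (auto simp: sesqm_step_def Let_def decrease_test_iff x_in_C \<Psi>_def)

text \<open>Dividing by \<open>\<gamma> k\<close> isolates \<open>P1\<close>, so that the sum rule yields a subgradient of \<open>P1\<close> itself.\<close>

lemma step_optimality:
  obtains p v where "p \<in> subdiff P1 (x (Suc k))" "v \<in> normal_cone C (x (Suc k))"
    "\<gamma> k *\<^sub>R (grad f (x k) - \<xi> k + p) + grad (G (\<mu> k)) (x k)
       + (L k / \<mu> k) *\<^sub>R (x (Suc k) - x k) + v = 0"
proof -
  let ?a = "\<gamma> k *\<^sub>R (grad f (x k) - \<xi> k) + grad (G (\<mu> k)) (x k)"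
  let ?b = "?a + (L k / \<mu> k) *\<^sub>R (x (Suc k) - x k)"
  note g = \<gamma>_pos[of k]
  have "convex_on UNIV (\<lambda>z. \<gamma> k * P1 z)"
    using convex_P1 g by (intro convex_on_cmul) auto
  note var = minimizer_linear_variational[OF this convex_C x_in_C[of "Suc k"], where a = ?a
      and k = "L k / \<mu> k" and ?x0.0 = "x k"]
  have "P1 (x (Suc k)) \<le> P1 y + ((1 / \<gamma> k) *\<^sub>R ?b) \<bullet> (y - x (Suc k))" if "y \<in> C" for y
  proof -
    have "\<gamma> k * P1 (x (Suc k)) \<le> \<gamma> k * P1 y + ?b \<bullet> (y - x (Suc k))"
      by (rule var[OF that]) (use step_sub_solution[of k] in \<open>simp add: sub_solution_iff[OF C_nonempty]\<close>)
    also have "\<dots> = \<gamma> k * (P1 y + ((1 / \<gamma> k) *\<^sub>R ?b) \<bullet> (y - x (Suc k)))"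
      using g by (subst inner_scaleR_left) (simp add: distrib_left)
    finally show ?thesis using g by (simp only: mult_le_cancel_left_pos)
  qed
  from minimizer_subgradient[OF convex_P1 convex_C x_in_C this]
  obtain p where p: "p \<in> subdiff P1 (x (Suc k))"
    "- ((1 / \<gamma> k) *\<^sub>R ?b + p) \<in> normal_cone C (x (Suc k))" by blast
  from normal_cone_scaleR[OF p(2), of "\<gamma> k"] g
  have "- (?b + \<gamma> k *\<^sub>R p) \<in> normal_cone C (x (Suc k))"
    by (simp add: scaleR_right_diff_distrib)
  with p(1) show ?thesis
    by (rule that) (simp add: algebra_simps)
qed

end

section \<open>Accounting along a run\<close>

lemma eps_subdiff_mono: "\<xi> \<in> eps_subdiff a \<phi> x \<Longrightarrow> a \<le> b \<Longrightarrow> \<xi> \<in> eps_subdiff b \<phi> x"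
  unfolding eps_subdiff_def by (auto intro: order_trans[rotated])

lemma norm_ge_cq_constant:
  assumes "cq_constant C h c \<eta>" "x \<in> C" "h (c x) \<ge> - \<eta>" "u \<in> eps_subdiff \<eta> h (c x)"
    and v: "v \<in> normal_cone C x"
  shows "\<eta> \<le> norm (adjoint (frechet_derivative c (at x)) u + v)"
proof -
  have "\<eta> \<le> infdist 0 {adjoint (frechet_derivative c (at x)) u + v | v. v \<in> normal_cone C x}"
    using assms by (auto simp: cq_constant_def)
  also have "\<dots> \<le> dist 0 (adjoint (frechet_derivative c (at x)) u + v)"
    using v by (intro infdist_le) auto
  finally show ?thesis by simp
qed

context sesqm
begin

text \<open>The last term compensates the increase of \<open>G \<mu>\<close> when \<open>\<mu>\<close> decreases, and subtracting the lower bound \<open>m\<close>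
  makes the first term decrease together with \<open>\<gamma>\<close>.\<close>

definition potential :: "real \<Rightarrow> nat \<Rightarrow> real" where
  "potential m k = \<gamma> k * (\<Psi> (x k) - m) + G (\<mu> k) (x k) + (\<alpha>4h + \<alpha>4\<phi>) * \<mu> k"

text \<open>The total decrease available to the potential, in the scale of
  \<open>norm (x (Suc k) - x k)^2 / \<mu> k\<close>.\<close>

definition budget :: "real \<Rightarrow> real" where
  "budget m = 2 * (potential m 0 + pos_part (pos_part \<alpha>31h + \<alpha>31\<phi>) * \<mu> 0) / c1"

lemma \<gamma>_Suc_le: "\<gamma> (Suc k) \<le> \<gamma> k"
  by (simp add: \<gamma>_def t_Suc \<gamma>hat_antimono)

lemma potential_decrease:
  assumes m: "\<And>y. y \<in> C \<Longrightarrow> m \<le> \<Psi> y"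
  shows "potential m (Suc k) \<le> potential m k - c1 / (2 * \<mu> k) * (norm (x (Suc k) - x k))\<^sup>2"
proof -
  have "G (\<mu> (Suc k)) (x (Suc k))
      \<le> G (\<mu> k) (x (Suc k)) + (\<alpha>4h + \<alpha>4\<phi>) * (\<mu> k - \<mu> (Suc k))"
    by (intro G_mono \<mu>_pos \<mu>_mono) simp
  moreover have "\<gamma> (Suc k) * (\<Psi> (x (Suc k)) - m) \<le> \<gamma> k * (\<Psi> (x (Suc k)) - m)"
    using m[OF x_in_C] by (intro mult_right_mono \<gamma>_Suc_le) simp
  ultimately show ?thesis
    using step_decrease[of k] unfolding potential_def by (simp only: right_diff_distrib)
qed

lemma potential_lower:
  assumes m: "\<And>y. y \<in> C \<Longrightarrow> m \<le> \<Psi> y"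
  shows "0 \<le> potential m k + pos_part (pos_part \<alpha>31h + \<alpha>31\<phi>) * \<mu> 0"
proof -
  let ?p = "pos_part (pos_part \<alpha>31h + \<alpha>31\<phi>)"
  have "\<alpha>31\<phi> * \<mu> k \<le> ?p * \<mu> k"
    using \<mu>_pos[of k] by (intro mult_right_mono) (auto simp: pos_part_def)
  also have "\<dots> \<le> ?p * \<mu> 0" by (intro mult_left_mono \<mu>_mono) (auto simp: pos_part_def)
  finally have "0 \<le> G (\<mu> k) (x k) + ?p * \<mu> 0" using G_lower[OF \<mu>_pos[of k], of "x k"] by simp
  moreover have "0 \<le> \<gamma> k * (\<Psi> (x k) - m)" using \<gamma>_pos[of k] m[OF x_in_C] by simp
  moreover have "0 \<le> (\<alpha>4h + \<alpha>4\<phi>) * \<mu> k" using const_nonneg \<mu>_pos[of k] by simp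
  ultimately show ?thesis unfolding potential_def by linarith
qed

lemma sum_squared_steps_le:
  assumes m: "\<And>y. y \<in> C \<Longrightarrow> m \<le> \<Psi> y"
  shows "(\<Sum>k<N. (norm (x (Suc k) - x k))\<^sup>2 / \<mu> k) \<le> budget m"
proof -
  have "c1 / 2 * (\<Sum>k<N. (norm (x (Suc k) - x k))\<^sup>2 / \<mu> k) \<le> potential m 0 - potential m N"
  proof (induction N)
    case (Suc N)
    have "c1 / (2 * \<mu> N) * (norm (x (Suc N) - x N))\<^sup>2 = c1 / 2 * ((norm (x (Suc N) - x N))\<^sup>2 / \<mu> N)"
      by simp
    then show ?case
      using Suc potential_decrease[OF m, of N] unfolding sum.lessThan_Suc distrib_left by linarith
  qed simp
  also have "\<dots> \<le> potential m 0 + pos_part (pos_part \<alpha>31h + \<alpha>31\<phi>) * \<mu> 0"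
    using potential_lower[OF m, of N] by simp
  finally show ?thesis using c1 by (simp add: budget_def field_simps)
qed

lemma budget_nonneg:
  assumes "\<And>y. y \<in> C \<Longrightarrow> m \<le> \<Psi> y"
  shows "0 \<le> budget m"
  using sum_squared_steps_le[OF assms, of 0] by simp

text \<open>The KKT residual after step \<open>k\<close> is at most this constant times
  \<open>norm (x (Suc k) - x k) / (\<gamma> k * \<mu> k)\<close>.\<close>

definition step_const :: real where
  "step_const = M\<^sub>L + \<mu> 0 * \<gamma>hat 0 * L\<^sub>f + \<mu> 0 * lip_grad (\<mu> 0)"

lemma M\<^sub>L_pos: "0 < M\<^sub>L"
  using L_pos[of 0] L_le[of 0] by linarith

lemma step_const_pos: "0 < step_const"
  using M\<^sub>L_pos \<mu>_pos[of 0] \<gamma>hat_pos[of 0] L\<^sub>f_nonneg lip_grad_nonneg[OF \<mu>_pos]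
  by (auto simp: step_const_def intro!: add_pos_nonneg)

lemma scaled_lip_grad_le: "\<mu> k * lip_grad (\<mu> k) \<le> \<mu> 0 * lip_grad (\<mu> 0)"
  by (intro lip_grad_scaled_mono \<mu>_pos \<mu>_mono) simp

text \<open>The optimality condition is shifted from the gradients at \<open>x k\<close> to those at \<open>x (Suc k)\<close>; the
  difference is Lipschitz in the step.  The point \<open>x k\<close>, where the subgradient of \<open>P2\<close> is taken, serves as
  the second point of the KKT condition.\<close>

lemma kkt_point_if_small_step:
  assumes feas: "hs (\<mu> k) (c (x (Suc k))) \<le> 2 * (\<alpha>31\<phi> + \<alpha>32\<phi>) * \<mu> k"
    and \<epsilon>: "(\<alpha>31h + \<alpha>32h) * \<mu> k \<le> \<epsilon>2"
      "(2 * (\<alpha>31\<phi> + \<alpha>32\<phi>) + pos_part \<alpha>31h) * \<mu> k \<le> \<epsilon>2"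
      "(2 * (\<alpha>31\<phi> + \<alpha>32\<phi>) + pos_part \<alpha>31h) * \<mu> k \<le> \<epsilon>2 * \<gamma> k"
      "((\<alpha>31\<phi> + \<alpha>32\<phi>) + pos_part \<alpha>32h) * \<mu> k \<le> \<epsilon>2 * \<gamma> k"
    and small: "step_const * norm (x (Suc k) - x k) \<le> \<epsilon>1 * (\<gamma> k * \<mu> k)"
      "norm (x (Suc k) - x k) \<le> \<epsilon>1 * \<epsilon>2"
  shows "kkt_point f P1 P2 C h c \<epsilon>1 \<epsilon>2 (x (Suc k))"
proof -
  note m = \<mu>_pos[of k] and g = \<gamma>_pos[of k]
  define y where "y = x (Suc k)"
  define s where "s = hs (\<mu> k) (c y)"
  define a where "a = grad (\<phi>s (\<mu> k)) s"
  define u where "u = grad (hs (\<mu> k)) (c y)"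
  define l where "l = a / \<gamma> k"
  let ?A = "adjoint (frechet_derivative c (at y))"
  note yC = x_in_C[of "Suc k", folded y_def] and xC = x_in_C[of k]
  have a: "0 \<le> a" "a \<le> 1" using grad_\<phi>s_bounds[OF m] by (auto simp: a_def)
  have Gy: "grad (G (\<mu> k)) y = a *\<^sub>R ?A u"
    using grad_G[OF m] by (simp add: a_def s_def u_def)
  obtain p v where p: "p \<in> subdiff P1 y" and v: "v \<in> normal_cone C y"
    and opt: "\<gamma> k *\<^sub>R (grad f (x k) - \<xi> k + p) + grad (G (\<mu> k)) (x k)
       + (L k / \<mu> k) *\<^sub>R (y - x k) + v = 0"
    using step_optimality[of k] unfolding y_def by blast
  have v': "(1 / \<gamma> k) *\<^sub>R v \<in> normal_cone C y" using v g by (intro normal_cone_scaleR) auto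
  \<comment> \<open>the residual with the normal vector of the subproblem; its norm need not be small\<close>
  define w where "w = grad f y + p - \<xi> k + l *\<^sub>R ?A u + (1 / \<gamma> k) *\<^sub>R v"
  have wd: "w \<bullet> d \<le> \<epsilon>1 * norm d" if d: "d \<in> direction_space C" for d
  proof -
    have "\<gamma> k *\<^sub>R w = \<gamma> k *\<^sub>R (grad f y + p - \<xi> k) + grad (G (\<mu> k)) y + v"
      using g by (simp add: w_def l_def Gy scaleR_add_right)
    also have "\<dots> = \<gamma> k *\<^sub>R (grad f y - grad f (x k))
        + (grad (G (\<mu> k)) y - grad (G (\<mu> k)) (x k)) - (L k / \<mu> k) *\<^sub>R (y - x k)"
      using opt by (simp add: algebra_simps add_eq_0_iff2)
    finally have "\<gamma> k * (w \<bullet> d) = \<gamma> k * ((grad f y - grad f (x k)) \<bullet> d)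
        + (grad (G (\<mu> k)) y - grad (G (\<mu> k)) (x k)) \<bullet> d - (L k / \<mu> k) * ((y - x k) \<bullet> d)"
      by (metis inner_add_left inner_diff_left inner_scaleR_left)
    also have "\<dots> \<le> \<gamma> k * (L\<^sub>f * norm (y - x k) * norm d)
        + lip_grad (\<mu> k) * norm (y - x k) * norm d + (L k / \<mu> k) * (norm (y - x k) * norm d)"
    proof -
      have "- ((y - x k) \<bullet> d) \<le> norm (y - x k) * norm d"
        using norm_cauchy_schwarz[of "- (y - x k)" d] by (simp only: inner_minus_left norm_minus_cancel)
      then have "(L k / \<mu> k) * - ((y - x k) \<bullet> d) \<le> (L k / \<mu> k) * (norm (y - x k) * norm d)"
        using L_pos[of k] m by (intro mult_left_mono) auto
      moreover have "\<gamma> k * ((grad f y - grad f (x k)) \<bullet> d) \<le> \<gamma> k * (L\<^sub>f * norm (y - x k) * norm d)"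
        using g by (intro mult_left_mono grad_f_inner_lipschitz yC xC) auto
      ultimately show ?thesis using grad_G_lipschitz[OF m xC yC d] by simp
    qed
    finally have "\<mu> k * (\<gamma> k * (w \<bullet> d)) \<le> \<mu> k * (\<gamma> k * (L\<^sub>f * norm (y - x k) * norm d)
        + lip_grad (\<mu> k) * norm (y - x k) * norm d + (L k / \<mu> k) * (norm (y - x k) * norm d))"
      using m by (intro mult_left_mono) auto
    also have "\<dots> = (\<mu> k * \<gamma> k * L\<^sub>f + \<mu> k * lip_grad (\<mu> k) + L k) * norm (y - x k) * norm d"
      using m by (simp add: algebra_simps)
    also have "\<dots> \<le> step_const * norm (y - x k) * norm d"
    proof -
      have "\<mu> k * \<gamma> k * L\<^sub>f \<le> \<mu> 0 * \<gamma>hat 0 * L\<^sub>f"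
        using \<gamma>_le[of k] \<mu>_mono[of 0 k] g m \<mu>_pos[of 0] L\<^sub>f_nonneg
        by (intro mult_right_mono mult_mono) auto
      then show ?thesis using scaled_lip_grad_le[of k] L_le[of k]
        by (intro mult_right_mono) (auto simp: step_const_def)
    qed
    also have "\<dots> \<le> \<epsilon>1 * (\<gamma> k * \<mu> k) * norm d"
      using small(1) by (intro mult_right_mono) (auto simp: y_def)
    finally have "(\<mu> k * \<gamma> k) * (w \<bullet> d) \<le> (\<mu> k * \<gamma> k) * (\<epsilon>1 * norm d)"
      by (simp add: algebra_simps)
    then show ?thesis using m g by simp
  qed
  have "0 \<le> \<epsilon>1 * (\<gamma> k * \<mu> k)"
    using small(1) step_const_pos by (meson mult_nonneg_nonneg norm_ge_zero order_trans less_imp_le)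
  then have e1: "0 \<le> \<epsilon>1" using mult_pos_pos[OF g m] by (simp add: zero_le_mult_iff)
  obtain v'' where v'': "v'' \<in> normal_cone C y" "norm (w + (v'' - (1 / \<gamma> k) *\<^sub>R v)) \<le> \<epsilon>1"
    using normal_cone_absorbs[OF v' e1 wd] by blast
  define R where "R = kkt_residuals f P1 P2 C c y (x k) l u"
  have R: "grad f y + p - \<xi> k + l *\<^sub>R ?A u + v'' \<in> R"
    unfolding R_def kkt_residuals_def using p \<xi>_subdiff v''(1) by blast
  have "infdist 0 R \<le> dist 0 (grad f y + p - \<xi> k + l *\<^sub>R ?A u + v'')"
    by (rule infdist_le[OF R])
  also have "\<dots> \<le> \<epsilon>1" using v''(2) by (simp add: w_def)
  finally have dist: "infdist 0 R \<le> \<epsilon>1" .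
  have hb: "h (c y) - pos_part \<alpha>31h * \<mu> k \<le> s" "s \<le> h (c y) + pos_part \<alpha>32h * \<mu> k"
  proof -
    have "\<alpha>31h * \<mu> k \<le> pos_part \<alpha>31h * \<mu> k" "\<alpha>32h * \<mu> k \<le> pos_part \<alpha>32h * \<mu> k"
      using m by (auto intro!: mult_right_mono simp: pos_part_def)
    then show "h (c y) - pos_part \<alpha>31h * \<mu> k \<le> s" "s \<le> h (c y) + pos_part \<alpha>32h * \<mu> k"
      using hs_bounds[OF m, of "c y"] by (auto simp: s_def)
  qed
  have hle: "h (c y) \<le> (2 * (\<alpha>31\<phi> + \<alpha>32\<phi>) + pos_part \<alpha>31h) * \<mu> k"
    using hb(1) feas by (simp add: s_def y_def algebra_simps)
  have "a * h (c y) \<le> \<epsilon>2 * \<gamma> k"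
  proof (cases "h (c y) \<le> 0")
    case True
    have "0 \<le> \<epsilon>2 * \<gamma> k"
      using \<epsilon>(1) const_nonneg(8) m g by (meson mult_nonneg_nonneg less_imp_le order_trans)
    with True a show ?thesis by (meson mult_nonneg_nonpos order_trans)
  next
    case False
    then have "a * h (c y) \<le> 1 * h (c y)" using a by (intro mult_right_mono) auto
    then show ?thesis using hle \<epsilon>(3) by simp
  qed
  moreover have "a * (- h (c y)) \<le> \<epsilon>2 * \<gamma> k"
  proof -
    have p32: "0 \<le> pos_part \<alpha>32h * \<mu> k" using m by (simp add: pos_part_def)
    have "a * (- h (c y)) \<le> a * (- s) + a * (pos_part \<alpha>32h * \<mu> k)"
      using mult_left_mono[OF hb(2) a(1)] by (simp add: algebra_simps)
    moreover have "a * (pos_part \<alpha>32h * \<mu> k) \<le> 1 * (pos_part \<alpha>32h * \<mu> k)"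
      using a p32 by (intro mult_right_mono) auto
    moreover have "a * (- s) \<le> (\<alpha>31\<phi> + \<alpha>32\<phi>) * \<mu> k"
    proof (cases "s < 0")
      case True
      then show ?thesis using grad_\<phi>s_neg[OF m True] by (simp add: a_def)
    next
      case False
      then have "a * (- s) \<le> 0" using a by (intro mult_nonneg_nonpos) auto
      moreover have "0 \<le> (\<alpha>31\<phi> + \<alpha>32\<phi>) * \<mu> k" using const_nonneg m by simp
      ultimately show ?thesis by linarith
    qed
    ultimately show ?thesis using \<epsilon>(4) by (simp add: algebra_simps)
  qed
  ultimately have "\<bar>l * h (c y)\<bar> \<le> \<epsilon>2"
    using g by (simp add: l_def abs_le_iff field_simps)
  moreover have "u \<in> eps_subdiff \<epsilon>2 h (c y)"
    using eps_subdiff_mono[OF grad_hs_eps_subdiff[OF m] \<epsilon>(1)] by (simp add: u_def)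
  moreover have "0 \<le> l" using a g by (simp add: l_def)
  moreover have "R \<noteq> {}" using R by auto
  moreover have "norm (y - x k) \<le> \<epsilon>1 * \<epsilon>2" using small(2) by (simp add: y_def)
  ultimately show ?thesis
    unfolding kkt_point_def y_def[symmetric]
    using yC xC dist order_trans[OF hle \<epsilon>(2)] by (intro conjI exI[of _ "x k"] exI[of _ u] exI[of _ l])
      (auto simp: R_def)
qed

abbreviation dual_bound :: real where
  "dual_bound \<equiv> grad_bound f C + subgrad_bound P1 C + subgrad_bound P2 C
     + c2 * (M\<^sub>L + \<mu> 0 * lip_grad (\<mu> 0))"

lemma dual_bound_pos: "0 < dual_bound"
proof -
  obtain p where "p \<in> subdiff P1 (x (Suc 0))" using step_optimality[of 0] by blast
  from norm_subgrad_le_bound[OF convex_P1 compact_C x_in_C this]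
  have "0 \<le> subgrad_bound P1 C" using norm_ge_zero order_trans by blast
  moreover have "0 \<le> subgrad_bound P2 C"
    using norm_subgrad_le_bound[OF convex_P2 compact_C x_in_C \<xi>_subdiff] norm_ge_zero order_trans
    by blast
  moreover have "0 \<le> grad_bound f C"
    using norm_grad_le_bound[OF C1_f compact_C x_in_C] norm_ge_zero order_trans by blast
  moreover have "0 < c2 * (M\<^sub>L + \<mu> 0 * lip_grad (\<mu> 0))"
    using c2 M\<^sub>L_pos \<mu>_pos[of 0] lip_grad_nonneg[OF \<mu>_pos]
    by (intro mult_pos_pos add_pos_nonneg) auto
  ultimately show ?thesis by linarith
qed

lemma \<gamma>_threshold_pos:
  assumes "cq_constant C h c \<eta>" "0 < M"
  shows "0 < min (\<eta> / (2 * M * dual_bound)) (\<gamma>hat k)"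
  using assms dual_bound_pos \<gamma>hat_pos by (simp add: cq_constant_def)

text \<open>At an update the slope of \<open>\<phi>s\<close> is at least \<open>1 / 2\<close>, and every other term of the optimality condition carries
  a factor \<open>\<gamma> k\<close>, the step included by the second condition of the update test.\<close>

lemma \<gamma>_ge_at_update:
  assumes cq: "cq_constant C h c \<eta>" and upd: "step_updates k"
    and \<mu>: "max (\<alpha>31h + \<alpha>32h) (pos_part \<alpha>32h) * \<mu> k \<le> \<eta>"
  shows "\<eta> \<le> 2 * \<gamma> k * dual_bound"
proof -
  note m = \<mu>_pos[of k] and g = \<gamma>_pos[of k]
  define y where "y = x (Suc k)"
  define s where "s = hs (\<mu> k) (c y)"
  define a where "a = grad (\<phi>s (\<mu> k)) s"
  define u where "u = grad (hs (\<mu> k)) (c y)"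
  let ?A = "adjoint (frechet_derivative c (at y))"
  note yC = x_in_C[of "Suc k", folded y_def] and xC = x_in_C[of k]
  have big: "2 * (\<alpha>31\<phi> + \<alpha>32\<phi>) * \<mu> k < s" and small: "norm (y - x k) \<le> c2 * \<mu> k * \<gamma> k"
    using upd by (auto simp: step_updates_def y_def s_def)
  have a: "1 / 2 \<le> a" unfolding a_def by (rule grad_\<phi>s_ge_half[OF m big])
  have Gy: "grad (G (\<mu> k)) y = a *\<^sub>R ?A u"
    using grad_G[OF m] by (simp add: a_def s_def u_def)
  have \<mu>': "(\<alpha>31h + \<alpha>32h) * \<mu> k \<le> \<eta>" "pos_part \<alpha>32h * \<mu> k \<le> \<eta>"
    using \<mu> mult_right_mono[OF max.cobounded1 less_imp_le[OF m], of "\<alpha>31h + \<alpha>32h" "pos_part \<alpha>32h"]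
      mult_right_mono[OF max.cobounded2 less_imp_le[OF m], of "pos_part \<alpha>32h" "\<alpha>31h + \<alpha>32h"]
    by linarith+
  have "u \<in> eps_subdiff \<eta> h (c y)"
    using eps_subdiff_mono[OF grad_hs_eps_subdiff[OF m] \<mu>'(1)] by (simp add: u_def)
  moreover have "- \<eta> \<le> h (c y)"
  proof -
    have "0 \<le> (\<alpha>31\<phi> + \<alpha>32\<phi>) * \<mu> k" using const_nonneg m by simp
    then have "0 \<le> s" using big by (simp add: algebra_simps)
    moreover have "\<alpha>32h * \<mu> k \<le> pos_part \<alpha>32h * \<mu> k"
      using m by (auto intro!: mult_right_mono simp: pos_part_def)
    ultimately show ?thesis using hs_bounds(2)[OF m, of "c y"] \<mu>'(2) by (simp add: s_def)
  qed
  ultimately have cq': "\<eta> \<le> norm (?A u + v)" if "v \<in> normal_cone C y" for v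
    using norm_ge_cq_constant[OF cq yC _ _ that] by blast
  obtain p v where p: "p \<in> subdiff P1 y" and v: "v \<in> normal_cone C y"
    and opt: "\<gamma> k *\<^sub>R (grad f (x k) - \<xi> k + p) + grad (G (\<mu> k)) (x k)
       + (L k / \<mu> k) *\<^sub>R (y - x k) + v = 0"
    using step_optimality[of k] unfolding y_def by blast
  define w where "w = a *\<^sub>R ?A u + v"
  define q where "q = grad f (x k) - \<xi> k + p"
  have q: "norm q \<le> grad_bound f C + subgrad_bound P1 C + subgrad_bound P2 C"
  proof -
    have "norm q \<le> norm (grad f (x k)) + norm (\<xi> k) + norm p"
      unfolding q_def by norm
    then show ?thesis
      using norm_subgrad_le_bound[OF convex_P1 compact_C yC p]
        norm_subgrad_le_bound[OF convex_P2 compact_C xC \<xi>_subdiff]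
        norm_grad_le_bound[OF C1_f compact_C xC] by linarith
  qed
  have wd: "w \<bullet> d \<le> (\<gamma> k * dual_bound) * norm d" if d: "d \<in> direction_space C" for d
  proof -
    have "w = - (\<gamma> k *\<^sub>R q)
        + (grad (G (\<mu> k)) y - grad (G (\<mu> k)) (x k)) - (L k / \<mu> k) *\<^sub>R (y - x k)"
      using opt unfolding w_def q_def Gy by (simp add: algebra_simps add_eq_0_iff2)
    then have "w \<bullet> d = \<gamma> k * (- (q \<bullet> d))
        + (grad (G (\<mu> k)) y - grad (G (\<mu> k)) (x k)) \<bullet> d + (L k / \<mu> k) * (- ((y - x k) \<bullet> d))"
      by (simp only: inner_add_left inner_diff_left inner_minus_left inner_scaleR_left
          mult_minus_right)
    also have "\<dots> \<le> \<gamma> k * (norm q * norm d)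
        + lip_grad (\<mu> k) * norm (y - x k) * norm d + (L k / \<mu> k) * (norm (y - x k) * norm d)"
    proof -
      have cs: "- (b \<bullet> d) \<le> norm b * norm d" for b
        using norm_cauchy_schwarz[of "- b" d] by (simp only: inner_minus_left norm_minus_cancel)
      show ?thesis
        using L_pos[of k] m g by (intro add_mono mult_left_mono cs grad_G_lipschitz[OF m xC yC d]) auto
    qed
    also have "\<dots> = (\<gamma> k * norm q + (lip_grad (\<mu> k) + L k / \<mu> k) * norm (y - x k)) * norm d"
      by (simp add: algebra_simps)
    also have "\<dots> \<le> (\<gamma> k * dual_bound) * norm d"
    proof (rule mult_right_mono)
      have "(lip_grad (\<mu> k) + L k / \<mu> k) * norm (y - x k)
          \<le> (lip_grad (\<mu> k) + L k / \<mu> k) * (c2 * \<mu> k * \<gamma> k)"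
        using small lip_grad_nonneg[OF m] L_pos[of k] m by (intro mult_left_mono) auto
      also have "\<dots> = (\<gamma> k * c2) * (L k + \<mu> k * lip_grad (\<mu> k))"
        using m by (simp add: field_simps)
      also have "\<dots> \<le> (\<gamma> k * c2) * (M\<^sub>L + \<mu> 0 * lip_grad (\<mu> 0))"
        using g c2 L_le[of k] scaled_lip_grad_le[of k] by (intro mult_left_mono add_mono) auto
      finally have "(lip_grad (\<mu> k) + L k / \<mu> k) * norm (y - x k)
          \<le> \<gamma> k * (c2 * (M\<^sub>L + \<mu> 0 * lip_grad (\<mu> 0)))" by (simp only: mult.assoc)
      with mult_left_mono[OF q less_imp_le[OF g]]
      show "\<gamma> k * norm q + (lip_grad (\<mu> k) + L k / \<mu> k) * norm (y - x k) \<le> \<gamma> k * dual_bound"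
        unfolding distrib_left by linarith
    qed simp
    finally show ?thesis .
  qed
  have B0: "0 \<le> \<gamma> k * dual_bound" using g dual_bound_pos by (intro mult_nonneg_nonneg) auto
  obtain v' where v': "v' \<in> normal_cone C y" "norm (w + (v' - v)) \<le> \<gamma> k * dual_bound"
    using normal_cone_absorbs[OF v B0 wd] by blast
  have "(1 / a) *\<^sub>R v' \<in> normal_cone C y" using v' a by (intro normal_cone_scaleR) auto
  from cq'[OF this] have "a * \<eta> \<le> a * norm (?A u + (1 / a) *\<^sub>R v')"
    using a by (intro mult_left_mono) auto
  also have "\<dots> = norm (a *\<^sub>R (?A u + (1 / a) *\<^sub>R v'))" using a by (simp only: norm_scaleR)
  also have "a *\<^sub>R (?A u + (1 / a) *\<^sub>R v') = w + (v' - v)"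
    using a by (simp add: w_def scaleR_add_right)
  also note v'(2)
  finally have "a * \<eta> \<le> \<gamma> k * dual_bound" .
  moreover have "1 / 2 * \<eta> \<le> a * \<eta>"
    using a cq by (intro mult_right_mono) (auto simp: cq_constant_def)
  ultimately show ?thesis by simp
qed

lemma t_le: "t k \<le> k"
  by (induction k) (auto simp: t_0 t_Suc)

text \<open>An update with \<open>k \<ge> k0\<close> is governed by \<open>\<gamma>_ge_at_update\<close> and costs at most a factor \<open>M\<close>.  Before \<open>k0\<close> the
  smoothing may be too coarse for the constraint qualification to apply, but then there have been at most \<open>k0\<close> updates.\<close>

lemma \<gamma>_ge:
  assumes cq: "cq_constant C h c \<eta>"
    and k0: "max (\<alpha>31h + \<alpha>32h) (pos_part \<alpha>32h) * \<mu> k0 \<le> \<eta>"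
    and M: "\<And>k. \<gamma>hat k \<le> M * \<gamma>hat (Suc k)" "0 < M"
  shows "min (\<eta> / (2 * M * dual_bound)) (\<gamma>hat (k0 + 1)) \<le> \<gamma> k"
proof (induction k)
  case 0
  then show ?case by (simp add: \<gamma>_def t_0 \<gamma>hat_antimono min.coboundedI2)
next
  case (Suc k)
  consider "\<not> step_updates k" | "k < k0" | "step_updates k" "k0 \<le> k" by linarith
  then show ?case
  proof cases
    case 1
    then show ?thesis using Suc by (simp add: \<gamma>_def t_Suc)
  next
    case 2
    then have "\<gamma>hat (k0 + 1) \<le> \<gamma> (Suc k)"
      unfolding \<gamma>_def using t_le[of "Suc k"] by (intro \<gamma>hat_antimono) simp
    then show ?thesis by simp
  next
    case 3
    have "max (\<alpha>31h + \<alpha>32h) (pos_part \<alpha>32h) * \<mu> k \<le> \<eta>"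
    proof (rule order_trans[OF mult_left_mono[OF \<mu>_mono[OF 3(2)]] k0])
      show "0 \<le> max (\<alpha>31h + \<alpha>32h) (pos_part \<alpha>32h)" by (simp add: pos_part_def le_max_iff_disj)
    qed
    from \<gamma>_ge_at_update[OF cq 3(1) this]
    have "\<eta> \<le> 2 * dual_bound * \<gamma> k" by (simp only: ac_simps)
    also have "\<dots> \<le> 2 * dual_bound * (M * \<gamma> (Suc k))"
      using M(1)[of "t k"] 3(1) less_imp_le[OF dual_bound_pos]
      by (intro mult_left_mono) (simp_all only: \<gamma>_def t_Suc if_True mult_nonneg_nonneg zero_le_numeral)
    finally have "\<eta> \<le> (2 * M * dual_bound) * \<gamma> (Suc k)" by (simp only: ac_simps)
    then have "\<eta> / (2 * M * dual_bound) \<le> \<gamma> (Suc k)"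
      using dual_bound_pos M(2) by (subst pos_divide_le_eq) (auto intro!: mult_pos_pos simp only: mult.commute)
    then show ?thesis by simp
  qed
qed

lemma t_eq_card_updates: "t k = card {j. j < k \<and> step_updates j}"
proof (induction k)
  case (Suc k)
  have "{j. j < Suc k \<and> step_updates j}
      = (if step_updates k then insert k {j. j < k \<and> step_updates j} else {j. j < k \<and> step_updates j})"
    by (auto simp: less_Suc_eq)
  then show ?case by (simp add: t_Suc Suc)
qed (simp add: t_0)

text \<open>At least half of the first \<open>K + 1\<close> indices lie in the window and are not update steps.  If all of them violated
  the conclusion, the sum of the squared steps over \<open>\<mu>\<close> would exceed the budget.\<close>

lemma small_step_exists:
  assumes m: "\<And>y. y \<in> C \<Longrightarrow> m \<le> \<Psi> y"
    and n: "t (Suc K) \<le> n" "n \<le> (K + 1) div 2"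
    and q: "0 \<le> q" "budget m \<le> q * \<mu> K * (real K + 1) / 2"
  shows "\<exists>k. (K + 1) div 2 - n \<le> k \<and> k \<le> K \<and> \<not> step_updates k \<and>
    (norm (x (Suc k) - x k))\<^sup>2 \<le> q * (\<mu> k)\<^sup>2"
proof (rule ccontr)
  assume none: "\<not> ?thesis"
  define N where "N = (K + 1) div 2 - n"
  define A where "A = {N..K} - {j. j < Suc K \<and> step_updates j}"
  let ?n = "\<lambda>k. (norm (x (Suc k) - x k))\<^sup>2 / \<mu> k"
  have fin: "finite A" by (simp add: A_def)
  have "card {N..K} \<le> card A + card {j. j < Suc K \<and> step_updates j}"
    unfolding A_def using card_Un_le[of "{N..K} - {j. j < Suc K \<and> step_updates j}"
        "{j. j < Suc K \<and> step_updates j}"] card_mono[of "({N..K} - {j. j < Suc K \<and> step_updates j}) \<union>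
        {j. j < Suc K \<and> step_updates j}" "{N..K}"] by auto
  then have "Suc K - N \<le> card A + n"
    using n(1) by (simp add: t_eq_card_updates)
  then have "K + 1 \<le> 2 * card A" using n(2) unfolding N_def by linarith
  then have "real (K + 1) \<le> real (2 * card A)" by (rule of_nat_mono)
  then have card: "(real K + 1) / 2 \<le> real (card A)" by simp
  then have ne: "A \<noteq> {}" by auto
  have "q * \<mu> K * (real K + 1) / 2 \<le> q * \<mu> K * real (card A)"
    using mult_left_mono[OF card, of "q * \<mu> K"] q \<mu>_pos[of K] by simp
  also have "\<dots> = (\<Sum>k\<in>A. q * \<mu> K)" by simp
  also have "\<dots> < (\<Sum>k\<in>A. ?n k)"
  proof (rule sum_strict_mono[OF fin ne])
    fix k assume k: "k \<in> A"
    then have "q * (\<mu> k)\<^sup>2 < (norm (x (Suc k) - x k))\<^sup>2"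
      using none by (force simp: A_def N_def)
    then have "q * \<mu> k < ?n k"
      using \<mu>_pos[of k] by (simp add: field_simps power2_eq_square)
    moreover have "q * \<mu> K \<le> q * \<mu> k"
      using k q(1) by (intro mult_left_mono \<mu>_mono) (auto simp: A_def)
    ultimately show "q * \<mu> K < ?n k" by simp
  qed
  also have "\<dots> \<le> (\<Sum>k<Suc K. ?n k)"
    using \<mu>_pos by (intro sum_mono2) (auto simp: A_def less_imp_le)
  also have "\<dots> \<le> budget m" by (rule sum_squared_steps_le[OF m])
  finally show False using q(2) by simp
qed

end

section \<open>Iteration complexity\<close>

text \<open>For \<open>\<epsilon>1 < 1\<close> the factor \<open>\<epsilon>1^2\<close> can be pulled out of the minimum, and for \<open>\<epsilon>2 < 1\<close> every additive
  constant is absorbed by \<open>\<epsilon>2 powr (- (1 / r)) \<ge> 1\<close>.\<close>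

lemma iteration_count_bound:
  fixes r :: real
  assumes r: "0 < r" "r < 1" and pos: "0 < s" "0 < a" "0 < b" "0 < d" "0 < e"
  shows "\<exists>B>0. \<forall>\<epsilon>1 \<epsilon>2. 0 < \<epsilon>1 \<and> \<epsilon>1 < 1 \<and> 0 < \<epsilon>2 \<and> \<epsilon>2 < 1 \<longrightarrow>
    (\<exists>K::nat. real K \<ge> max (s powr (- (1 / (1 - r))) * (min (a * \<epsilon>1\<^sup>2) b) powr (- (1 / (1 - r))))
        (2 * real n + 2 * d powr (- (1 / r)) * (\<epsilon>2 / e) powr (- (1 / r))) \<and>
      real (K + 1) \<le> B * max (\<epsilon>1 powr (- (2 / (1 - r)))) (\<epsilon>2 powr (- (1 / r))))"
proof -
  let ?p = "- (1 / (1 - r))"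
  define D1 where "D1 = s powr ?p * (min a b) powr ?p"
  define D2 where "D2 = 2 * d powr (- (1 / r)) * e powr (1 / r)"
  define B where "B = D1 + 2 * real n + D2 + 2"
  have D: "0 \<le> D1" "0 \<le> D2" by (auto simp: D1_def D2_def)
  have "\<exists>K::nat. real K \<ge> max (s powr ?p * (min (a * \<epsilon>1\<^sup>2) b) powr ?p)
        (2 * real n + 2 * d powr (- (1 / r)) * (\<epsilon>2 / e) powr (- (1 / r))) \<and>
      real (K + 1) \<le> B * max (\<epsilon>1 powr (- (2 / (1 - r)))) (\<epsilon>2 powr (- (1 / r)))"
    if \<epsilon>: "0 < \<epsilon>1" "\<epsilon>1 < 1" "0 < \<epsilon>2" "\<epsilon>2 < 1" for \<epsilon>1 \<epsilon>2
  proof -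
    define E1 where "E1 = \<epsilon>1 powr (- (2 / (1 - r)))"
    define E2 where "E2 = \<epsilon>2 powr (- (1 / r))"
    define E where "E = max E1 E2"
    define T1 where "T1 = s powr ?p * (min (a * \<epsilon>1\<^sup>2) b) powr ?p"
    define T2 where "T2 = 2 * real n + 2 * d powr (- (1 / r)) * (\<epsilon>2 / e) powr (- (1 / r))"
    have "1 = 1 powr (- (1 / r))" by simp
    also have "\<dots> \<le> E2"
      unfolding E2_def using r \<epsilon> by (intro powr_mono2') auto
    finally have E: "1 \<le> E" "E1 \<le> E" "E2 \<le> E" by (auto simp: E_def)
    have "min a b * \<epsilon>1\<^sup>2 \<le> min (a * \<epsilon>1\<^sup>2) b"
    proof -
      have "min a b * \<epsilon>1\<^sup>2 \<le> a * \<epsilon>1\<^sup>2" by (intro mult_right_mono) auto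
      moreover have "min a b * \<epsilon>1\<^sup>2 \<le> b * 1"
        using \<epsilon> pos by (intro mult_mono) (auto simp: power_le_one)
      ultimately show ?thesis by simp
    qed
    then have "(min (a * \<epsilon>1\<^sup>2) b) powr ?p \<le> (min a b * \<epsilon>1\<^sup>2) powr ?p"
      using pos r \<epsilon> by (intro powr_mono2') auto
    also have "\<dots> = (min a b) powr ?p * E1"
    proof -
      have "\<epsilon>1\<^sup>2 = \<epsilon>1 powr 2" using \<epsilon> by simp
      then have "(\<epsilon>1\<^sup>2) powr ?p = \<epsilon>1 powr (2 * ?p)" by (simp only: powr_powr)
      then show ?thesis using pos \<epsilon> by (simp add: powr_mult E1_def)
    qed
    finally have "T1 \<le> D1 * E1"
      unfolding T1_def D1_def mult.assoc by (intro mult_left_mono) auto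
    also have "\<dots> \<le> D1 * E" using D E by (intro mult_left_mono) auto
    finally have T1: "T1 \<le> D1 * E" .
    have "(\<epsilon>2 / e) powr (- (1 / r)) = E2 * e powr (1 / r)"
      using \<epsilon> pos by (simp add: powr_divide E2_def powr_minus divide_simps)
    then have "T2 = 2 * real n + D2 * E2"
      by (simp add: T2_def D2_def)
    also have "\<dots> \<le> 2 * real n * E + D2 * E"
      using D E by (intro add_mono mult_left_mono) (auto simp: mult_le_cancel_left1)
    finally have T2: "T2 \<le> 2 * real n * E + D2 * E" .
    have T0: "0 \<le> T2" by (simp add: T2_def)
    define K where "K = nat \<lceil>max T1 T2\<rceil>"
    have "max T1 T2 \<le> real K" unfolding K_def by linarith
    moreover have "real (K + 1) \<le> max T1 T2 + 2"
      using T0 unfolding K_def by linarith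
    moreover have "max T1 T2 + 2 \<le> B * E"
    proof -
      have "0 \<le> D1 * E" "0 \<le> D2 * E" "0 \<le> 2 * real n * E" using D E by auto
      then show ?thesis using T1 T2 E(1) unfolding B_def distrib_right by linarith
    qed
    ultimately show ?thesis
      unfolding T1_def T2_def E_def E1_def E2_def by (intro exI[of _ K] conjI) linarith+
  qed
  moreover have "0 < B" using D by (simp add: B_def add_nonneg_pos)
  ultimately show ?thesis by blast
qed

context sesqm
begin

text \<open>The first lower bound on \<open>K\<close> makes the steps found by \<open>small_step_exists\<close> short enough, the second places
  the window where \<open>\<mu> k \<le> M4 * \<epsilon>2\<close>.  The bound by \<open>c2\<close> in the first one serves to read off from the absence
  of an update that the smoothed constraint value is small.\<close>

lemma kkt_point_in_window:
  assumes cq: "cq_constant C h c \<eta>"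
    and k0: "max (\<alpha>31h + \<alpha>32h) (pos_part \<alpha>32h) * \<mu> k0 \<le> \<eta>"
    and M: "\<And>k. \<gamma>hat k \<le> M * \<gamma>hat (Suc k)" "0 < M" and lim: "\<gamma>hat \<longlonglongrightarrow> 0"
    and \<eta>\<gamma>: "\<eta>\<^sub>\<gamma> = min (\<eta> / (2 * M * dual_bound)) (\<gamma>hat (k0 + 1))"
    and Mt: "Mt = Max {s. \<gamma>hat s \<ge> \<eta>\<^sub>\<gamma>}"
    and m: "\<And>y. y \<in> C \<Longrightarrow> m \<le> \<Psi> y"
    and M2: "M2 = 1 + (real Mt + 1) * budget m"
    and \<mu>: "\<And>k. \<mu> k = \<mu>0 * (1 + real k) powr (- r)" and r: "0 < r" "r < 1"
    and M4: "0 < M4" "(\<alpha>31h + \<alpha>32h) * M4 \<le> 1"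
      "(3 * (\<alpha>31\<phi> + \<alpha>32\<phi>) + pos_part \<alpha>31h) * M4 \<le> 1"
      "(3 * (\<alpha>31\<phi> + \<alpha>32\<phi>) + pos_part \<alpha>31h + pos_part \<alpha>32h) * M4 \<le> \<eta>\<^sub>\<gamma>"
      "\<eta>\<^sub>\<gamma> * M4 \<le> step_const"
    and \<epsilon>: "0 < \<epsilon>1" "0 < \<epsilon>2"
    and K: "real K \<ge> (\<mu>0 / 2 powr (2 * r + 1)) powr (- (1 / (1 - r)))
          * (min (\<eta>\<^sub>\<gamma>\<^sup>2 * \<epsilon>1\<^sup>2 / (step_const\<^sup>2 * M2)) (\<eta>\<^sub>\<gamma>\<^sup>2 * c2\<^sup>2 / M2)) powr (- (1 / (1 - r)))"
      "real K \<ge> 2 * real Mt + 2 * M4 powr (- (1 / r)) * (\<epsilon>2 / \<mu>0) powr (- (1 / r))"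
  shows "\<exists>k. \<lceil>real K / 2\<rceil> - int Mt \<le> int k \<and> k \<le> K \<and> kkt_point f P1 P2 C h c \<epsilon>1 \<epsilon>2 (x (k + 1))"
proof -
  have \<mu>0: "0 < \<mu>0" using \<mu>_pos[of 0] by (simp add: \<mu>)
  have M2_1: "1 \<le> M2" "budget m \<le> M2"
    using budget_nonneg[OF m] by (auto simp: M2 distrib_right)
  have \<eta>\<gamma>0: "0 < \<eta>\<^sub>\<gamma>" unfolding \<eta>\<gamma> by (rule \<gamma>_threshold_pos[OF cq M(2)])
  have \<gamma>\<eta>: "\<eta>\<^sub>\<gamma> \<le> \<gamma> k" for k unfolding \<eta>\<gamma> by (rule \<gamma>_ge[OF cq k0 M])
  have tM: "t k \<le> Mt" for k
  proof -
    obtain N where "\<And>s. N \<le> s \<Longrightarrow> \<gamma>hat s < \<eta>\<^sub>\<gamma>"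
      using order_tendstoD(2)[OF lim \<eta>\<gamma>0] by (auto simp: eventually_sequentially)
    then have "{s. \<gamma>hat s \<ge> \<eta>\<^sub>\<gamma>} \<subseteq> {..<N}" by (auto simp: not_less[symmetric])
    then have "finite {s. \<gamma>hat s \<ge> \<eta>\<^sub>\<gamma>}" by (rule finite_subset) simp
    then show ?thesis unfolding Mt using \<gamma>\<eta>[of k] by (intro Max_ge) (auto simp: \<gamma>_def)
  qed
  \<comment> \<open>the index from which on \<open>\<mu> k \<le> M4 * \<epsilon>2\<close>\<close>
  define Z where "Z = (M4 * (\<epsilon>2 / \<mu>0)) powr (- (1 / r))"
  have Z0: "0 < Z" using M4(1) \<epsilon> \<mu>0 by (simp add: Z_def)
  have KZ: "real K \<ge> 2 * real Mt + 2 * Z"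
  proof -
    have "Z = M4 powr (- (1 / r)) * (\<epsilon>2 / \<mu>0) powr (- (1 / r))"
      unfolding Z_def by (rule powr_mult)
    then show ?thesis using K(2) by (simp only: mult.assoc)
  qed
  have MtK: "Mt \<le> (K + 1) div 2" using KZ Z0 by linarith
  define q' where "q' = min (\<eta>\<^sub>\<gamma>\<^sup>2 * \<epsilon>1\<^sup>2 / (step_const\<^sup>2 * M2)) (\<eta>\<^sub>\<gamma>\<^sup>2 * c2\<^sup>2 / M2)"
  \<comment> \<open>a bound for \<open>(norm (x (Suc k) - x k) / \<mu> k)^2\<close> that suffices for the residual and for the update test\<close>
  define q where "q = M2 * q'"
  have q'0: "0 < q'" using \<eta>\<gamma>0 \<epsilon> step_const_pos c2 M2_1(1) by (auto simp: q'_def)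
  have q0: "0 \<le> q" using q'0 M2_1(1) by (simp add: q_def)
  have q1: "q \<le> (\<eta>\<^sub>\<gamma> * \<epsilon>1 / step_const)\<^sup>2" "q \<le> (\<eta>\<^sub>\<gamma> * c2)\<^sup>2"
  proof -
    have "q \<le> M2 * (\<eta>\<^sub>\<gamma>\<^sup>2 * \<epsilon>1\<^sup>2 / (step_const\<^sup>2 * M2))"
      unfolding q_def q'_def using M2_1(1) by (intro mult_left_mono[OF min.cobounded1]) simp
    moreover have "q \<le> M2 * (\<eta>\<^sub>\<gamma>\<^sup>2 * c2\<^sup>2 / M2)"
      unfolding q_def q'_def using M2_1(1) by (intro mult_left_mono[OF min.cobounded2]) simp
    ultimately show "q \<le> (\<eta>\<^sub>\<gamma> * \<epsilon>1 / step_const)\<^sup>2" "q \<le> (\<eta>\<^sub>\<gamma> * c2)\<^sup>2"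
      using M2_1(1) by (auto simp: power_divide power_mult_distrib)
  qed
  have "budget m \<le> q * \<mu> K * (real K + 1) / 2"
  proof -
    define A where "A = \<mu>0 / 2 powr (2 * r + 1) * q'"
    have A0: "0 < A" using \<mu>0 q'0 by (simp add: A_def)
    have "A powr (- (1 / (1 - r))) \<le> real K + 1"
      using K(1) \<mu>0 q'0 unfolding q'_def[symmetric] A_def by (simp add: powr_mult powr_divide)
    then have "(A powr (- (1 / (1 - r)))) powr (1 - r) \<le> (real K + 1) powr (1 - r)"
      using r by (intro powr_mono2) auto
    moreover have "(A powr (- (1 / (1 - r)))) powr (1 - r) = 1 / A"
    proof -
      have "- (1 / (1 - r)) * (1 - r) = - 1" using r by simp
      then have "(A powr (- (1 / (1 - r)))) powr (1 - r) = A powr (- 1)"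
        by (simp only: powr_powr)
      then show ?thesis using A0 by (simp add: powr_minus_divide)
    qed
    ultimately have "1 \<le> A * (real K + 1) powr (1 - r)"
      using A0 by (simp add: divide_simps mult.commute)
    also have "\<dots> \<le> \<mu>0 / 2 * q' * (real K + 1) powr (1 - r)"
    proof (intro mult_right_mono)
      have "(2::real) powr 1 \<le> 2 powr (2 * r + 1)" using r by (intro powr_mono) auto
      then show "A \<le> \<mu>0 / 2 * q'"
        unfolding A_def using \<mu>0 q'0 by (intro mult_right_mono divide_left_mono) auto
    qed (use q'0 in auto)
    also have "(real K + 1) powr (1 - r) = (1 + real K) powr (- r) * (real K + 1)"
      using powr_add[of "1 + real K" "- r" 1] by (simp add: add.commute)
    also have "\<mu>0 / 2 * q' * \<dots> = q' * \<mu> K * (real K + 1) / 2"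
      by (simp add: \<mu>)
    finally have "M2 * 1 \<le> M2 * (q' * \<mu> K * (real K + 1) / 2)"
      using M2_1(1) by (intro mult_left_mono) auto
    then show ?thesis using M2_1(2) by (simp add: q_def mult.assoc)
  qed
  from small_step_exists[OF m tM MtK q0 this] obtain k where k: "(K + 1) div 2 - Mt \<le> k" "k \<le> K"
    "\<not> step_updates k" "(norm (x (Suc k) - x k))\<^sup>2 \<le> q * (\<mu> k)\<^sup>2" by blast
  define n where "n = norm (x (Suc k) - x k)"
  note mu = \<mu>_pos[of k] and g = \<gamma>_pos[of k]
  have n1: "n \<le> \<eta>\<^sub>\<gamma> * \<epsilon>1 / step_const * \<mu> k"
  proof (rule power2_le_imp_le)
    have "n\<^sup>2 \<le> (\<eta>\<^sub>\<gamma> * \<epsilon>1 / step_const)\<^sup>2 * (\<mu> k)\<^sup>2"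
      using k(4) mult_right_mono[OF q1(1), of "(\<mu> k)\<^sup>2"] by (simp add: n_def)
    then show "n\<^sup>2 \<le> (\<eta>\<^sub>\<gamma> * \<epsilon>1 / step_const * \<mu> k)\<^sup>2" by (simp only: power_mult_distrib)
  qed (use \<eta>\<gamma>0 \<epsilon> step_const_pos mu in simp)
  have n2: "n \<le> \<eta>\<^sub>\<gamma> * c2 * \<mu> k"
  proof (rule power2_le_imp_le)
    have "n\<^sup>2 \<le> (\<eta>\<^sub>\<gamma> * c2)\<^sup>2 * (\<mu> k)\<^sup>2"
      using k(4) mult_right_mono[OF q1(2), of "(\<mu> k)\<^sup>2"] by (simp add: n_def)
    then show "n\<^sup>2 \<le> (\<eta>\<^sub>\<gamma> * c2 * \<mu> k)\<^sup>2" by (simp only: power_mult_distrib)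
  qed (use \<eta>\<gamma>0 c2 mu in simp)
  have "\<eta>\<^sub>\<gamma> * (c2 * \<mu> k) \<le> \<gamma> k * (c2 * \<mu> k)"
    using \<gamma>\<eta>[of k] c2 mu by (intro mult_right_mono) auto
  then have "n \<le> c2 * \<mu> k * \<gamma> k" using n2 by (simp only: ac_simps)
  then have feas: "hs (\<mu> k) (c (x (Suc k))) \<le> 2 * (\<alpha>31\<phi> + \<alpha>32\<phi>) * \<mu> k"
    using k(3) by (simp add: step_updates_def n_def)
  have \<mu>k: "\<mu> k \<le> M4 * \<epsilon>2"
  proof -
    have "Z \<le> 1 + real k" using KZ k(1) by linarith
    then have "(1 + real k) powr (- r) \<le> Z powr (- r)"
      using r Z0 by (intro powr_mono2') auto
    also have "\<dots> = M4 * (\<epsilon>2 / \<mu>0)"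
      using r M4(1) \<epsilon> \<mu>0 by (simp add: Z_def powr_powr)
    finally show ?thesis using \<mu>0 by (simp add: \<mu> field_simps)
  qed
  have scale: "b * \<mu> k \<le> \<epsilon>2 * d" if "b * M4 \<le> d" "0 \<le> b" for b d
  proof -
    have "b * \<mu> k \<le> b * (M4 * \<epsilon>2)" using \<mu>k that by (intro mult_left_mono) auto
    also have "\<dots> = \<epsilon>2 * (b * M4)" by simp
    also have "\<dots> \<le> \<epsilon>2 * d" using that \<epsilon> by (intro mult_left_mono) auto
    finally show ?thesis .
  qed
  note pos = const_nonneg(8,9)
  have pp: "0 \<le> pos_part s" for s by (simp add: pos_part_def)
  have weak: "b * M4 \<le> d" if "b' * M4 \<le> d" "b \<le> b'" for b b' d
    using mult_right_mono[OF that(2), of M4] M4(1) that(1) by linarith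
  note M4\<gamma> = order_trans[OF M4(4) \<gamma>\<eta>[of k]]
  have "kkt_point f P1 P2 C h c \<epsilon>1 \<epsilon>2 (x (Suc k))"
  proof (rule kkt_point_if_small_step[OF feas])
    show "(\<alpha>31h + \<alpha>32h) * \<mu> k \<le> \<epsilon>2"
      using scale[OF M4(2)] pos by simp
    show "(2 * (\<alpha>31\<phi> + \<alpha>32\<phi>) + pos_part \<alpha>31h) * \<mu> k \<le> \<epsilon>2"
      using scale[OF weak[OF M4(3), of "2 * (\<alpha>31\<phi> + \<alpha>32\<phi>) + pos_part \<alpha>31h"]] pos pp[of \<alpha>31h] by simp
    show "(2 * (\<alpha>31\<phi> + \<alpha>32\<phi>) + pos_part \<alpha>31h) * \<mu> k \<le> \<epsilon>2 * \<gamma> k"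
      using pos pp[of \<alpha>31h] pp[of \<alpha>32h] by (intro scale[OF weak[OF M4\<gamma>]]) auto
    show "((\<alpha>31\<phi> + \<alpha>32\<phi>) + pos_part \<alpha>32h) * \<mu> k \<le> \<epsilon>2 * \<gamma> k"
      using pos pp[of \<alpha>31h] pp[of \<alpha>32h] by (intro scale[OF weak[OF M4\<gamma>]]) auto
    have "step_const * n \<le> \<epsilon>1 * (\<eta>\<^sub>\<gamma> * \<mu> k)"
      using n1 step_const_pos by (simp add: field_simps)
    also have "\<dots> \<le> \<epsilon>1 * (\<gamma> k * \<mu> k)"
      using \<gamma>\<eta>[of k] \<epsilon> mu by (intro mult_left_mono mult_right_mono) auto
    finally show "step_const * norm (x (Suc k) - x k) \<le> \<epsilon>1 * (\<gamma> k * \<mu> k)" by (simp add: n_def)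
    have "\<eta>\<^sub>\<gamma> * \<mu> k \<le> \<epsilon>2 * step_const" using scale[OF M4(5)] \<eta>\<gamma>0 by simp
    then have "\<epsilon>1 * (\<eta>\<^sub>\<gamma> * \<mu> k) \<le> \<epsilon>1 * (\<epsilon>2 * step_const)" using \<epsilon> by (intro mult_left_mono) auto
    then have "step_const * n \<le> step_const * (\<epsilon>1 * \<epsilon>2)"
      using \<open>step_const * n \<le> \<epsilon>1 * (\<eta>\<^sub>\<gamma> * \<mu> k)\<close> by (simp add: algebra_simps)
    then show "norm (x (Suc k) - x k) \<le> \<epsilon>1 * \<epsilon>2" using step_const_pos by (simp add: n_def)
  qed
  moreover have "\<lceil>real K / 2\<rceil> \<le> int k + int Mt"
    using k(1) by (intro ceiling_le) linarith
  ultimately show "\<exists>k. \<lceil>real K / 2\<rceil> - int Mt \<le> int k \<and> k \<le> K \<and>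
      kkt_point f P1 P2 C h c \<epsilon>1 \<epsilon>2 (x (k + 1))"
    using k(2) by (intro exI[of _ k]) auto
qed

text \<open>The infimum is attained on \<open>C\<close>, so it is a finite number and taking its real part loses nothing.\<close>

lemma INF_\<psi>_le:
  assumes "y \<in> C"
  shows "real_of_ereal (INF y. \<psi>_fn f P1 P2 C y) \<le> \<Psi> y"
proof -
  have \<psi>: "\<psi>_fn f P1 P2 C y = (if y \<in> C then ereal (\<Psi> y) else \<infinity>)" for y
    by (simp add: \<psi>_fn_def indicator_fn_def \<Psi>_def)
  have "continuous_on C \<Psi>"
    unfolding \<Psi>_def
    by (intro continuous_intros convex_on_imp_continuous_on convex_P1 convex_P2 C1_continuous_on C1_f)
  from continuous_attains_inf[OF compact_C C_nonempty this]
  obtain y0 where y0: "y0 \<in> C" "\<And>y. y \<in> C \<Longrightarrow> \<Psi> y0 \<le> \<Psi> y" by blast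
  have "(INF y. \<psi>_fn f P1 P2 C y) = ereal (\<Psi> y0)"
  proof (rule antisym)
    show "(INF y. \<psi>_fn f P1 P2 C y) \<le> ereal (\<Psi> y0)"
      by (rule INF_lower2[of y0]) (use y0 in \<open>auto simp: \<psi>\<close>)
    show "ereal (\<Psi> y0) \<le> (INF y. \<psi>_fn f P1 P2 C y)"
      by (rule INF_greatest) (use y0 in \<open>auto simp: \<psi>\<close>)
  qed
  then show ?thesis using y0(2)[OF assms] by simp
qed

end

theorem mainTheorem4:
  fixes f P1 P2 :: "'a::euclidean_space \<Rightarrow> real"
    and C :: "'a set"
    and c :: "'a \<Rightarrow> 'b::euclidean_space"
    and h :: "'b \<Rightarrow> real"
    and hs :: "real \<Rightarrow> 'b \<Rightarrow> real"
    and \<phi>s :: "real \<Rightarrow> real \<Rightarrow> real"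
    and \<gamma>hat \<mu> :: "nat \<Rightarrow> real"
    and x \<xi> :: "nat \<Rightarrow> 'a"
    and L0 L :: "nat \<Rightarrow> real"
    and t :: "nat \<Rightarrow> nat"
  assumes "compact C" and "convex C" and "{y \<in> C. h (c y) \<le> 0} \<noteq> {}"
    and "C1 f" and "C1 c"
    and "L\<^sub>f > 0" and "smooth_on L\<^sub>f C f"
    and "L\<^sub>c \<ge> 0" and "smooth_on L\<^sub>c C c"
    and "M\<^sub>c > 0" and "M\<^sub>c-lipschitz_on C c"
    and "convex_on UNIV P1" and "convex_on UNIV P2"
    and "convex_on UNIV h" and "M\<^sub>h > 0" and "M\<^sub>h-lipschitz_on UNIV h"
    \<comment> \<open>smoothing approximations of \<open>h\<close> and of the positive part\<close>
    and "smoothing_approx h hs \<alpha>1h \<alpha>2h \<alpha>31h \<alpha>32h" and "smoothing_mono hs \<alpha>4h"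
    and "smoothing_approx pos_part \<phi>s \<alpha>1\<phi> \<alpha>2\<phi> \<alpha>31\<phi> \<alpha>32\<phi>" and "smoothing_mono \<phi>s \<alpha>4\<phi>"
    and "\<alpha>3h = \<alpha>31h + \<alpha>32h" and "\<alpha>3\<phi> = \<alpha>31\<phi> + \<alpha>32\<phi>"
    and "\<alpha>1 = \<alpha>1h + M\<^sub>h\<^sup>2 * \<alpha>1\<phi>" and "\<alpha>2 = \<alpha>2h + M\<^sub>h\<^sup>2 * \<alpha>2\<phi>"
    and "\<alpha>31 = pos_part \<alpha>31h + \<alpha>31\<phi>" and "\<alpha>4 = \<alpha>4h + \<alpha>4\<phi>"
    and "\<And>m. L\<^sub>\<mu> m = M\<^sub>h * L\<^sub>c + \<alpha>1 * M\<^sub>c\<^sup>2 + \<alpha>2 * M\<^sub>c\<^sup>2 / m"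
    \<comment> \<open>the run of the algorithm\<close>
    and "\<mu>0 > 0" and "0 < r" and "r < 1"
    and "\<And>k. \<mu> k = \<mu>0 * (1 + real k) powr (- r)"
    and "0 < Llow" and "Llow \<le> Lup" and "c1 > 0" and "c2 > 0"
    and "sesqm_run f P1 P2 C c hs \<phi>s \<alpha>3\<phi> c1 c2 Llow Lup \<gamma>hat \<mu> x \<xi> L0 L t"
    and "CQ C h c"
    and "\<gamma>hat \<longlonglongrightarrow> 0" and "M\<^sub>\<gamma> > 1"
    and "\<And>k. 0 < \<gamma>hat (Suc k) \<and> \<gamma>hat (Suc k) < \<gamma>hat k \<and> \<gamma>hat k \<le> M\<^sub>\<gamma> * \<gamma>hat (Suc k)"
    \<comment> \<open>constants that do not involve \<open>\<eta>1\<close>\<close>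
    and "M\<^sub>L = max Lup (c1 + \<gamma>hat (t 0) * \<mu>0 * L\<^sub>f + \<mu>0 * L\<^sub>\<mu> \<mu>0)"
    and "M1 = M\<^sub>L + \<mu>0 * \<gamma>hat 0 * L\<^sub>f + \<mu>0 * L\<^sub>\<mu> \<mu>0"
    and "mbar = real_of_ereal (INF y. \<psi>_fn f P1 P2 C y)"
    and "Q0 = \<gamma>hat (t 0) * (real_of_ereal (\<psi>_fn f P1 P2 C (x 0)) - mbar)
              + g_smooth hs \<phi>s c \<mu>0 (x 0) + \<alpha>4 * \<mu>0"
  shows
    "(\<exists>\<eta>1. cq_constant C h c \<eta>1) \<and>
     (\<forall>\<eta>1 k0 \<eta>\<^sub>\<gamma> Mt M2 M3 M4.
        cq_constant C h c \<eta>1 \<longrightarrow>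
        k0 = (LEAST k. \<mu> k \<le> \<eta>1 / max \<alpha>3h (pos_part \<alpha>32h)) \<longrightarrow>
        \<eta>\<^sub>\<gamma> = min (\<eta>1 / (2 * M\<^sub>\<gamma> * (grad_bound f C + subgrad_bound P1 C + subgrad_bound P2 C
                                      + c2 * (M\<^sub>L + \<mu>0 * L\<^sub>\<mu> \<mu>0))))
                  (\<gamma>hat (k0 + 1)) \<longrightarrow>
        Mt = Max {s. \<gamma>hat s \<ge> \<eta>\<^sub>\<gamma>} \<longrightarrow>
        M2 = 1 + 2 * (real Mt + 1) * (Q0 + pos_part \<alpha>31 * \<mu>0) / c1 \<longrightarrow>
        M3 = (3 * \<alpha>3\<phi> + pos_part \<alpha>31h + pos_part \<alpha>32h) / \<eta>\<^sub>\<gamma> \<longrightarrow>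
        M4 = Min {1 / \<alpha>3h, 1 / M3, M1 / \<eta>\<^sub>\<gamma>, 1 / (3 * \<alpha>3\<phi> + pos_part \<alpha>31h)} \<longrightarrow>
        (\<forall>\<epsilon>1 \<epsilon>2 (K::nat).
           0 < \<epsilon>1 \<and> \<epsilon>1 < 1 \<and> 0 < \<epsilon>2 \<and> \<epsilon>2 < 1 \<and>
           real K \<ge> max
             ((\<mu>0 / 2 powr (2 * r + 1)) powr (- (1 / (1 - r)))
                * (min (\<eta>\<^sub>\<gamma>\<^sup>2 * \<epsilon>1\<^sup>2 / (M1\<^sup>2 * M2)) (\<eta>\<^sub>\<gamma>\<^sup>2 * c2\<^sup>2 / M2)) powr (- (1 / (1 - r))))
             (2 * real Mt + 2 * M4 powr (- (1 / r)) * (\<epsilon>2 / \<mu>0) powr (- (1 / r))) \<longrightarrow>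
           (\<exists>khat::nat. \<lceil>real K / 2\<rceil> - int Mt \<le> int khat \<and> khat \<le> K \<and>
              kkt_point f P1 P2 C h c \<epsilon>1 \<epsilon>2 (x (khat + 1))))) \<and>
     (\<exists>B>0. \<forall>\<epsilon>1 \<epsilon>2. 0 < \<epsilon>1 \<and> \<epsilon>1 < 1 \<and> 0 < \<epsilon>2 \<and> \<epsilon>2 < 1 \<longrightarrow>
        (\<exists>khat::nat.
           real (khat + 1) \<le> B * max (\<epsilon>1 powr (- (2 / (1 - r)))) (\<epsilon>2 powr (- (1 / r))) \<and>
           kkt_point f P1 P2 C h c \<epsilon>1 \<epsilon>2 (x (khat + 1)))) \<and>
     (r = 1 / 3 \<longrightarrow>
        (\<exists>B>0. \<forall>\<epsilon>1. 0 < \<epsilon>1 \<and> \<epsilon>1 < 1 \<longrightarrow>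
           (\<exists>khat::nat. real (khat + 1) \<le> B * \<epsilon>1 powr (- 3) \<and>
              kkt_point f P1 P2 C h c \<epsilon>1 \<epsilon>1 (x (khat + 1)))))"
proof -
  interpret S: sesqm C c h hs \<phi>s L\<^sub>c M\<^sub>c M\<^sub>h \<alpha>1h \<alpha>2h \<alpha>31h \<alpha>32h \<alpha>4h \<alpha>1\<phi> \<alpha>2\<phi> \<alpha>31\<phi> \<alpha>32\<phi> \<alpha>4\<phi>
    f P1 P2 L\<^sub>f c1 c2 Llow Lup \<gamma>hat \<mu> x \<xi> L0 L t
  proof unfold_locales
    show "0 < \<gamma>hat k" for k
      using assms(40)[of k] by (auto intro: less_trans)
    show "\<gamma>hat (Suc k) < \<gamma>hat k" for k using assms(40) by blast
    show "sesqm_run f P1 P2 C c hs \<phi>s (\<alpha>31\<phi> + \<alpha>32\<phi>) c1 c2 Llow Lup \<gamma>hat \<mu> x \<xi> L0 L t"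
      using assms(36) by (simp only: assms(22))
  qed (fact assms)+
  have \<alpha>3: "\<alpha>3h = \<alpha>31h + \<alpha>32h" "\<alpha>3\<phi> = \<alpha>31\<phi> + \<alpha>32\<phi>" by (fact assms)+
  have \<mu>: "\<mu> k = \<mu>0 * (1 + real k) powr (- r)" for k by (fact assms)
  have \<mu>0: "\<mu> 0 = \<mu>0" "0 < \<mu>0" using assms(28) by (auto simp: \<mu>)
  have r: "0 < r" "r < 1" by (fact assms)+
  have L\<mu>: "L\<^sub>\<mu> s = S.lip_grad s" for s
    by (simp add: assms(23,24,27) S.lip_grad_def)
  have M\<^sub>L: "M\<^sub>L = S.M\<^sub>L"
    by (simp add: assms(41) S.M\<^sub>L_def L\<mu> S.t_0 \<mu>0)
  have M1: "M1 = S.step_const"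
    by (simp add: assms(42) S.step_const_def L\<mu> \<mu>0 M\<^sub>L)
  have mbar: "mbar \<le> S.\<Psi> y" if "y \<in> C" for y
    using S.INF_\<psi>_le[OF that] by (simp add: assms(43))
  have "Q0 = S.potential mbar 0"
    using S.x_in_C[of 0]
    by (simp add: assms(26,44) S.potential_def S.\<gamma>_def \<mu>0 \<psi>_fn_def indicator_fn_def S.\<Psi>_def)
  then have budget: "2 * (Q0 + pos_part \<alpha>31 * \<mu>0) / c1 = S.budget mbar"
    by (simp add: S.budget_def assms(25) \<mu>0)
  have ratio: "\<gamma>hat k \<le> M\<^sub>\<gamma> * \<gamma>hat (Suc k)" for k using assms(40) by blast
  have M\<gamma>: "0 < M\<^sub>\<gamma>" using assms(39) by simp

  \<comment> \<open>the positivity of the constants is recorded for the asymptotic bound\<close>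
  have window: "0 < \<eta>\<^sub>\<gamma> \<and> 0 < M2 \<and> 0 < M4 \<and>
    (\<forall>\<epsilon>1 \<epsilon>2 (K::nat).
       0 < \<epsilon>1 \<and> \<epsilon>1 < 1 \<and> 0 < \<epsilon>2 \<and> \<epsilon>2 < 1 \<and>
       real K \<ge> max
         ((\<mu>0 / 2 powr (2 * r + 1)) powr (- (1 / (1 - r)))
            * (min (\<eta>\<^sub>\<gamma>\<^sup>2 * \<epsilon>1\<^sup>2 / (M1\<^sup>2 * M2)) (\<eta>\<^sub>\<gamma>\<^sup>2 * c2\<^sup>2 / M2)) powr (- (1 / (1 - r))))
         (2 * real Mt + 2 * M4 powr (- (1 / r)) * (\<epsilon>2 / \<mu>0) powr (- (1 / r))) \<longrightarrow>
       (\<exists>khat::nat. \<lceil>real K / 2\<rceil> - int Mt \<le> int khat \<and> khat \<le> K \<and>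
          kkt_point f P1 P2 C h c \<epsilon>1 \<epsilon>2 (x (khat + 1))))"
    if cq: "cq_constant C h c \<eta>1"
      and k0: "k0 = (LEAST k. \<mu> k \<le> \<eta>1 / max \<alpha>3h (pos_part \<alpha>32h))"
      and \<eta>\<gamma>: "\<eta>\<^sub>\<gamma> = min (\<eta>1 / (2 * M\<^sub>\<gamma> * (grad_bound f C + subgrad_bound P1 C + subgrad_bound P2 C
                                      + c2 * (M\<^sub>L + \<mu>0 * L\<^sub>\<mu> \<mu>0))))
                  (\<gamma>hat (k0 + 1))"
      and Mt: "Mt = Max {s. \<gamma>hat s \<ge> \<eta>\<^sub>\<gamma>}"
      and M2: "M2 = 1 + 2 * (real Mt + 1) * (Q0 + pos_part \<alpha>31 * \<mu>0) / c1"
      and M3: "M3 = (3 * \<alpha>3\<phi> + pos_part \<alpha>31h + pos_part \<alpha>32h) / \<eta>\<^sub>\<gamma>"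
      and M4: "M4 = Min {1 / \<alpha>3h, 1 / M3, M1 / \<eta>\<^sub>\<gamma>, 1 / (3 * \<alpha>3\<phi> + pos_part \<alpha>31h)}"
    for \<eta>1 k0 \<eta>\<^sub>\<gamma> Mt M2 M3 M4
  proof -
    let ?mx = "max (\<alpha>31h + \<alpha>32h) (pos_part \<alpha>32h)"
    have pp: "0 \<le> pos_part s" for s by (simp add: pos_part_def)
    have mx: "0 < ?mx" using S.const_nonneg(8) by (simp add: less_max_iff_disj)
    have \<eta>1: "0 < \<eta>1 / ?mx" using cq mx by (simp add: cq_constant_def)
    have "\<mu> \<longlonglongrightarrow> \<mu>0 * 0"
      unfolding \<mu> using r
      by (intro tendsto_mult tendsto_const tendsto_neg_powr
          filterlim_tendsto_add_at_top[OF tendsto_const filterlim_real_sequentially]) auto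
    then have "\<forall>\<^sub>F k in sequentially. \<mu> k < \<eta>1 / ?mx"
      using \<eta>1 by (intro order_tendstoD(2)[of \<mu> 0]) auto
    then have "\<exists>k. \<mu> k \<le> \<eta>1 / ?mx"
      by (auto simp: eventually_sequentially intro: less_imp_le)
    from LeastI_ex[OF this] have "\<mu> k0 \<le> \<eta>1 / ?mx" by (simp add: k0 \<alpha>3)
    then have k0': "?mx * \<mu> k0 \<le> \<eta>1" using mx by (simp add: pos_le_divide_eq mult.commute)
    have \<eta>\<gamma>': "\<eta>\<^sub>\<gamma> = min (\<eta>1 / (2 * M\<^sub>\<gamma> * S.dual_bound)) (\<gamma>hat (k0 + 1))"
      by (simp only: \<eta>\<gamma> M\<^sub>L L\<mu> \<mu>0)
    have \<eta>\<gamma>0: "0 < \<eta>\<^sub>\<gamma>" unfolding \<eta>\<gamma>' by (rule S.\<gamma>_threshold_pos[OF cq M\<gamma>])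
    have M2': "M2 = 1 + (real Mt + 1) * S.budget mbar"
      by (simp add: M2 budget[symmetric] algebra_simps)
    have M2_0: "0 < M2" using S.budget_nonneg[OF mbar] by (simp add: M2' add_pos_nonneg)
    let ?b1 = "3 * \<alpha>3\<phi> + pos_part \<alpha>31h" and ?b2 = "3 * \<alpha>3\<phi> + pos_part \<alpha>31h + pos_part \<alpha>32h"
    have pos: "0 < \<alpha>3h" "0 < ?b1" "0 < ?b2"
      using S.const_nonneg(8,9) pp[of \<alpha>31h] pp[of \<alpha>32h] by (auto simp: \<alpha>3 add_pos_nonneg)
    have M3_0: "0 < M3" using pos \<eta>\<gamma>0 by (simp add: M3)
    have M4_0: "0 < M4"
      using pos M3_0 \<eta>\<gamma>0 S.step_const_pos by (simp add: M4 M1)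
    have "M4 \<le> 1 / \<alpha>3h" "M4 \<le> 1 / M3" "M4 \<le> M1 / \<eta>\<^sub>\<gamma>" "M4 \<le> 1 / ?b1"
      unfolding M4 by (auto intro!: Min_le)
    then have M4_le: "(\<alpha>31h + \<alpha>32h) * M4 \<le> 1"
        "(3 * (\<alpha>31\<phi> + \<alpha>32\<phi>) + pos_part \<alpha>31h) * M4 \<le> 1"
        "(3 * (\<alpha>31\<phi> + \<alpha>32\<phi>) + pos_part \<alpha>31h + pos_part \<alpha>32h) * M4 \<le> \<eta>\<^sub>\<gamma>"
        "\<eta>\<^sub>\<gamma> * M4 \<le> S.step_const"
      using pos \<eta>\<gamma>0 unfolding \<alpha>3[symmetric] M1[symmetric] M3
      by (simp_all add: pos_le_divide_eq mult.commute)
    show ?thesis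
      using \<eta>\<gamma>0 M2_0 M4_0
        S.kkt_point_in_window[OF cq k0' ratio M\<gamma> assms(38) \<eta>\<gamma>' Mt mbar M2' \<mu> r M4_0 M4_le]
      unfolding M1 by (intro conjI allI impI) auto
  qed

  have ex: "\<exists>\<eta>1. cq_constant C h c \<eta>1"
    using cq_constant_exists[OF S.compact_C S.C1_c S.lip_h] assms(37) by blast
  then obtain \<eta>1 where cq: "cq_constant C h c \<eta>1" by blast
  have rate: "\<exists>B>0. \<forall>\<epsilon>1 \<epsilon>2. 0 < \<epsilon>1 \<and> \<epsilon>1 < 1 \<and> 0 < \<epsilon>2 \<and> \<epsilon>2 < 1 \<longrightarrow>
        (\<exists>khat::nat.
           real (khat + 1) \<le> B * max (\<epsilon>1 powr (- (2 / (1 - r)))) (\<epsilon>2 powr (- (1 / r))) \<and>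
           kkt_point f P1 P2 C h c \<epsilon>1 \<epsilon>2 (x (khat + 1)))"
  proof -
    obtain \<eta>\<^sub>\<gamma> Mt M2 M4 where w: "0 < \<eta>\<^sub>\<gamma>" "0 < M2" "0 < M4"
      and kkt: "\<And>\<epsilon>1 \<epsilon>2 (K::nat). 0 < \<epsilon>1 \<and> \<epsilon>1 < 1 \<and> 0 < \<epsilon>2 \<and> \<epsilon>2 < 1 \<and>
       real K \<ge> max
         ((\<mu>0 / 2 powr (2 * r + 1)) powr (- (1 / (1 - r)))
            * (min (\<eta>\<^sub>\<gamma>\<^sup>2 * \<epsilon>1\<^sup>2 / (M1\<^sup>2 * M2)) (\<eta>\<^sub>\<gamma>\<^sup>2 * c2\<^sup>2 / M2)) powr (- (1 / (1 - r))))
         (2 * real Mt + 2 * M4 powr (- (1 / r)) * (\<epsilon>2 / \<mu>0) powr (- (1 / r))) \<longrightarrow>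
       (\<exists>khat::nat. \<lceil>real K / 2\<rceil> - int Mt \<le> int khat \<and> khat \<le> K \<and>
          kkt_point f P1 P2 C h c \<epsilon>1 \<epsilon>2 (x (khat + 1)))"
      using window[OF cq refl refl refl refl refl refl] by blast
    let ?s = "\<mu>0 / 2 powr (2 * r + 1)" and ?a = "\<eta>\<^sub>\<gamma>\<^sup>2 / (M1\<^sup>2 * M2)" and ?b = "\<eta>\<^sub>\<gamma>\<^sup>2 * c2\<^sup>2 / M2"
    have p: "0 < ?s" "0 < ?a" "0 < ?b"
      using \<mu>0 w S.step_const_pos S.c2 by (auto simp: M1)
    obtain B where B: "B > 0" "\<And>\<epsilon>1 \<epsilon>2. 0 < \<epsilon>1 \<and> \<epsilon>1 < 1 \<and> 0 < \<epsilon>2 \<and> \<epsilon>2 < 1 \<Longrightarrow>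
      \<exists>K::nat. real K \<ge> max (?s powr (- (1 / (1 - r))) * (min (?a * \<epsilon>1\<^sup>2) ?b) powr (- (1 / (1 - r))))
        (2 * real Mt + 2 * M4 powr (- (1 / r)) * (\<epsilon>2 / \<mu>0) powr (- (1 / r))) \<and>
      real (K + 1) \<le> B * max (\<epsilon>1 powr (- (2 / (1 - r)))) (\<epsilon>2 powr (- (1 / r)))"
      using iteration_count_bound[OF r p w(3) \<mu>0(2), of Mt] by blast
    show ?thesis
    proof (intro exI[of _ B] conjI allI impI B(1))
      fix \<epsilon>1 \<epsilon>2 :: real assume \<epsilon>: "0 < \<epsilon>1 \<and> \<epsilon>1 < 1 \<and> 0 < \<epsilon>2 \<and> \<epsilon>2 < 1"
      obtain K :: nat where K: "real K \<ge> max (?s powr (- (1 / (1 - r))) * (min (?a * \<epsilon>1\<^sup>2) ?b) powr (- (1 / (1 - r))))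
        (2 * real Mt + 2 * M4 powr (- (1 / r)) * (\<epsilon>2 / \<mu>0) powr (- (1 / r)))"
        "real (K + 1) \<le> B * max (\<epsilon>1 powr (- (2 / (1 - r)))) (\<epsilon>2 powr (- (1 / r)))"
        using B(2)[OF \<epsilon>] by blast
      then obtain k where "k \<le> K" "kkt_point f P1 P2 C h c \<epsilon>1 \<epsilon>2 (x (k + 1))"
        using kkt[of \<epsilon>1 \<epsilon>2 K] \<epsilon> by auto
      with K(2) show "\<exists>khat::nat.
           real (khat + 1) \<le> B * max (\<epsilon>1 powr (- (2 / (1 - r)))) (\<epsilon>2 powr (- (1 / r))) \<and>
           kkt_point f P1 P2 C h c \<epsilon>1 \<epsilon>2 (x (khat + 1))"
        by (intro exI[of _ k]) auto
    qed
  qed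
  have rate_third: "r = 1 / 3 \<longrightarrow> (\<exists>B>0. \<forall>\<epsilon>1. 0 < \<epsilon>1 \<and> \<epsilon>1 < 1 \<longrightarrow>
           (\<exists>khat::nat. real (khat + 1) \<le> B * \<epsilon>1 powr (- 3) \<and>
              kkt_point f P1 P2 C h c \<epsilon>1 \<epsilon>1 (x (khat + 1))))"
  proof
    assume r3: "r = 1 / 3"
    obtain B where B: "B > 0" "\<And>\<epsilon>1 \<epsilon>2. 0 < \<epsilon>1 \<and> \<epsilon>1 < 1 \<and> 0 < \<epsilon>2 \<and> \<epsilon>2 < 1 \<Longrightarrow>
        \<exists>khat::nat.
           real (khat + 1) \<le> B * max (\<epsilon>1 powr (- (2 / (1 - r)))) (\<epsilon>2 powr (- (1 / r))) \<and>
           kkt_point f P1 P2 C h c \<epsilon>1 \<epsilon>2 (x (khat + 1))"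
      using rate by blast
    have exps: "2 / (1 - r) = 3" "1 / r = 3" unfolding r3 by simp_all
    show "\<exists>B>0. \<forall>\<epsilon>1. 0 < \<epsilon>1 \<and> \<epsilon>1 < 1 \<longrightarrow>
           (\<exists>khat::nat. real (khat + 1) \<le> B * \<epsilon>1 powr (- 3) \<and>
              kkt_point f P1 P2 C h c \<epsilon>1 \<epsilon>1 (x (khat + 1)))"
    proof (intro exI[of _ B] conjI allI impI B(1))
      fix \<epsilon>1 :: real assume "0 < \<epsilon>1 \<and> \<epsilon>1 < 1"
      then show "\<exists>khat::nat. real (khat + 1) \<le> B * \<epsilon>1 powr (- 3) \<and>
          kkt_point f P1 P2 C h c \<epsilon>1 \<epsilon>1 (x (khat + 1))"
        using B(2)[of \<epsilon>1 \<epsilon>1] unfolding exps max.idem by simp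
    qed
  qed
  note window' = window[THEN conjunct2, THEN conjunct2, THEN conjunct2, rule_format]
  show ?thesis
    by (rule conjI[OF ex conjI[OF _ conjI[OF rate rate_third]]])
       (intro allI impI, rule window', assumption+)
qed

end
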